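(* (a) If $0<q<1$ and $q<p<\infty$, then $\mathcal M(\mathcal D^p_{p-1}\cap H^\infty,\ \mathcal D^q_{q-1}\cap H^\infty)=\{0\}$. (b) If $1\le q<2\le p<\infty$, then $\mathcal M(\mathcal D^p_{p-1}\cap H^\infty,\ \mathcal D^q_{q-1}\cap H^\infty)=\{0\}$.
   Context: $\mathbb D$ is the open unit disc, $dA=\frac1\pi dx\,dy$. For $0<p<\infty$, $\mathcal D^p_{p-1}$ is the space of analytic $f$ in $\mathbb D$ with $\int_{\mathbb D}(1-|z|)^{p-1}|f'(z)|^p\,dA(z)<\infty$. $H^\infty$ is the space of bounded analytic functions on $\mathbb D$. For spaces $X,Y$ of analytic functions, $\mathcal M(X,Y)=\{g\text{ analytic in }\mathbb D: fg\in Y\text{ for all }f\in X\}$. *)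

theory Defs
  imports "HOL-Analysis.Analysis"
begin

text \<open>Analytic functions on the unit disc D = ball 0 1. A function on D is represented
  by a total function complex => complex, normalised to be 0 outside D, so that
  function equality coincides with equality on D.\<close>
definition analytic_disc :: "(complex \<Rightarrow> complex) \<Rightarrow> bool" where
  "analytic_disc f \<longleftrightarrow> f holomorphic_on ball 0 1 \<and> (\<forall>z. z \<notin> ball 0 1 \<longrightarrow> f z = 0)"

text \<open>Dirichlet type space D^p_{p-1}: integral over D of (1-|z|)^(p-1) |f'(z)|^p dA(z) finite,
  with dA = (1/pi) dx dy (Lebesgue measure on the complex plane divided by pi).\<close>
definition Dirichlet_type :: "real \<Rightarrow> (complex \<Rightarrow> complex) set" where
  "Dirichlet_type p = {f. analytic_disc f \<and>
     (\<integral>\<^sup>+ z \<in> ball 0 1. ennreal ((1 / pi) * (1 - cmod z) powr (p - 1) * cmod (deriv f z) powr p) \<partial>lborel) < \<infinity>}"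

definition H_infty :: "(complex \<Rightarrow> complex) set" where
  "H_infty = {f. analytic_disc f \<and> bounded (f ` ball 0 1)}"

definition multipliers :: "(complex \<Rightarrow> complex) set \<Rightarrow> (complex \<Rightarrow> complex) set \<Rightarrow> (complex \<Rightarrow> complex) set" where
  "multipliers X Y = {g. analytic_disc g \<and> (\<forall>f\<in>X. (\<lambda>z. f z * g z) \<in> Y)}"

end

theory Submission
  imports Defs "HOL-Complex_Analysis.Conformal_Mappings"
begin

text \<open>
  Both parts are instances of the case \<open>0 < q < 2\<close>, \<open>q < p\<close>. With \<open>a\<^sub>k = (k+1)\<^bsup>-1/q\<^esup>\<close>, an
  \<open>\<ell>\<^sup>2\<close> sequence, the Rudin--Shapiro recursion
  \<open>P\<^sub>k\<^sub>+\<^sub>1 = P\<^sub>k + a\<^sub>k z\<^sup>n Q\<^sub>k\<^sup>*\<close>, \<open>Q\<^sub>k\<^sub>+\<^sub>1 = Q\<^sub>k - a\<^sub>k z\<^sup>n P\<^sub>k\<^sup>*\<close> with very lacunary exponents \<open>n = n\<^sub>k\<close>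
  satisfies \<open>|P\<^sub>k|\<^sup>2 + |Q\<^sub>k|\<^sup>2 = \<Prod>\<^sub>j\<^sub><\<^sub>k (1 + a\<^sub>j\<^sup>2)\<close> on the circle, so \<open>P\<^sub>k\<close> converges to a bounded
  function \<open>f = \<Sum> a\<^sub>k z\<^sup>n Q\<^sub>k\<^sup>*\<close>. The lacunarity gives \<open>f \<in> D\<^sup>p\<close> because \<open>\<Sum> a\<^sub>k\<^sup>p < \<infinity>\<close>.
  If \<open>g \<noteq> 0\<close> were a multiplier, then \<open>(1-|z|)\<^bsup>q-1\<^esup> |f' g|\<^sup>q\<close> would be integrable, since \<open>1\<close> and \<open>f\<close> are both
  mapped into \<open>D\<^sup>q\<close> and \<open>f\<close> is bounded. But where \<open>1 - |z|\<close> is about \<open>1/n\<^sub>k\<close>, \<open>(1-|z|) |f'|\<close> is about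
  \<open>a\<^sub>k |Q\<^sub>k|\<close>. Factoring \<open>g = z\<^sup>d h\<close> with \<open>h(0) \<noteq> 0\<close> and using \<open>Q\<^sub>k(0) = 1\<close>, the mean value property
  of the uniformly bounded \<open>Q\<^sub>k h\<close> bounds the mean of \<open>|Q\<^sub>k g|\<^sup>q\<close> over this annulus from below, so the
  annulus contributes at least \<open>c a\<^sub>k\<^sup>q\<close> up to a summable error. This contradicts \<open>\<Sum> a\<^sub>k\<^sup>q = \<infinity>\<close>.
\<close>

subsection \<open>Rotation invariance and the area mean value property\<close>

definition vec2 :: "complex \<Rightarrow> real^2" where
  "vec2 z = vector [Re z, Im z]"

lemma vec2_nth [simp]: "vec2 z $ 1 = Re z" "vec2 z $ 2 = Im z"
  by (simp_all add: vec2_def)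

lemma linear_vec2: "linear vec2"
  by (rule linearI) (simp_all add: vec_eq_iff forall_2)

lemma norm_vec2 [simp]: "norm (vec2 z) = cmod z"
  by (simp add: norm_vec_def L2_set_def sum_2 cmod_def)

lemma borel_measurable_vec2 [measurable]: "vec2 \<in> borel_measurable borel"
  by (intro borel_measurable_continuous_onI linear_continuous_on linear_conv_bounded_linear[THEN iffD1] linear_vec2)

lemma bij_vec2: "bij vec2"
proof (rule bijI)
  show "inj vec2"
    by (rule injI) (metis complex_eqI vec2_nth)
  show "surj vec2"
    by (rule surjI[where f = "\<lambda>x. Complex (x$1) (x$2)"]) (simp add: vec_eq_iff forall_2)
qed

lemma lborel_distr_vec2: "distr lborel borel vec2 = lborel"
proof (rule lborel_eqI[symmetric])
  fix l u :: "real^2"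
  assume le: "\<And>b. b \<in> Basis \<Longrightarrow> l \<bullet> b \<le> u \<bullet> b"
  have pre: "vec2 -` box l u = box (Complex (l$1) (l$2)) (Complex (u$1) (u$2))"
    by (auto simp: mem_box Basis_vec_def forall_2 inner_axis Basis_complex_def)
  have B: "(Basis :: (real^2) set) = {axis 1 1, axis 2 1}"
    by (auto simp: Basis_vec_def UNIV_2)
  have "l $ 1 \<le> u $ 1" "l $ 2 \<le> u $ 2"
    using le[of "axis 1 1"] le[of "axis 2 1"] by (simp_all add: B inner_axis)
  then show "emeasure (distr lborel borel vec2) (box l u) = (\<Prod>b\<in>Basis. (u - l) \<bullet> b)"
    by (subst emeasure_distr)
       (simp_all add: pre emeasure_lborel_box_eq Basis_complex_def B axis_eq_axis inner_axis)
qed simp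

lemma emeasure_vec2_image:
  assumes "S \<in> sets borel"
  shows "vec2 ` S \<in> sets borel" "emeasure lborel (vec2 ` S) = emeasure lborel S"
proof -
  have "vec2 ` S = (\<lambda>x. Complex (x$1) (x$2)) -` S"
    using bij_vec2 by (auto simp: image_iff vec_eq_iff forall_2) (metis complex.sel)
  moreover have "(\<lambda>x::real^2. Complex (x$1) (x$2)) \<in> borel_measurable borel"
    by (intro borel_measurable_continuous_onI) (auto intro!: continuous_intros simp: Complex_eq)
  ultimately show *: "vec2 ` S \<in> sets borel"
    using assms by (simp add: measurable_sets_borel)
  have "emeasure lborel (vec2 ` S) = emeasure (distr lborel borel vec2) (vec2 ` S)"
    by (simp add: lborel_distr_vec2)
  also have "\<dots> = emeasure lborel S"
    using * bij_vec2 by (subst emeasure_distr) (auto simp: bij_def inj_vimage_image_eq)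
  finally show "emeasure lborel (vec2 ` S) = emeasure lborel S" .
qed

text \<open>Conjugation by \<open>vec2\<close> turns the rotation into an orthogonal map of
  \<open>real^2\<close>, which preserves Lebesgue measure; \<open>vec2\<close> itself preserves
  measure, so preimages of boxes keep their measure.\<close>

lemma lborel_distr_mult_unit:
  fixes c :: complex
  assumes c: "cmod c = 1"
  shows "distr lborel borel ((*) c) = lborel"
proof (rule lborel_eqI[symmetric])
  fix l u :: complex
  assume le: "\<And>b. b \<in> Basis \<Longrightarrow> l \<bullet> b \<le> u \<bullet> b"
  define S where "S = (*) c -` box l u"
  have c0: "c \<noteq> 0" using c by auto
  define T where "T = (\<lambda>x. vec2 (c * inv vec2 x))"
  have iv: "inv vec2 (vec2 z) = z" for z
    using bij_vec2 by (simp add: bij_def)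
  have vi: "vec2 (inv vec2 x) = x" for x
    using bij_vec2 by (simp add: bij_def surj_f_inv_f)
  have linv: "linear (inv vec2)"
  proof (rule linearI)
    show "inv vec2 (x + y) = inv vec2 x + inv vec2 y" for x y
      using linear_add[OF linear_vec2, of "inv vec2 x" "inv vec2 y"] by (metis iv vi)
    show "inv vec2 (r *\<^sub>R x) = r *\<^sub>R inv vec2 x" for r x
      using linear_scale[OF linear_vec2, of r "inv vec2 x"] by (metis iv vi)
  qed
  have T: "orthogonal_transformation T"
    unfolding orthogonal_transformation
  proof
    have "linear ((*) c)" by (simp add: linearI distrib_left)
    then have "linear (vec2 \<circ> ((*) c \<circ> inv vec2))"
      using linv linear_vec2 by (intro linear_compose)
    then show "linear T" by (simp add: T_def o_def)
    show "\<forall>v. norm (T v) = norm v"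
      using c by (metis T_def norm_vec2 norm_mult vi mult_1)
  qed
  have "(*) c \<in> borel_measurable borel"
    by (intro borel_measurable_continuous_onI continuous_intros)
  then have S: "S \<in> sets borel"
    unfolding S_def by (rule measurable_sets_borel) simp
  have Simg: "S = (*) (inverse c) ` box l u"
    unfolding S_def using c0 by (auto simp: image_iff field_simps)
  \<comment> \<open>Boundedness gives finite measure, so that equality of the real-valued
    \<open>measure\<close> can be lifted to \<open>emeasure\<close>.\<close>
  have "bounded S"
    unfolding Simg by (intro bounded_linear_image bounded_box bounded_linear_mult_right)
  then have "bounded (vec2 ` S)"
    using linear_vec2 bounded_linear_image linear_conv_bounded_linear by blast
  then have lm: "vec2 ` S \<in> lmeasurable"
    using emeasure_vec2_image(1)[OF S] by (intro bounded_set_imp_lmeasurable) auto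
  have "T ` vec2 ` S = vec2 ` box l u"
    unfolding Simg T_def image_image iv using c0 by (simp add: mult.assoc[symmetric])
  then have "measure lebesgue (vec2 ` box l u) = measure lebesgue (vec2 ` S)"
    using measure_orthogonal_image[OF T lm] by simp
  moreover have "vec2 ` box l u \<in> lmeasurable"
    using \<open>T ` vec2 ` S = _\<close> measurable_orthogonal_image[OF T lm] by simp
  ultimately have "emeasure lebesgue (vec2 ` box l u) = emeasure lebesgue (vec2 ` S)"
    using lm by (metis emeasure_eq_measure2)
  then have "emeasure lborel (box l u) = emeasure lborel S"
    using S emeasure_vec2_image[of S] emeasure_vec2_image[of "box l u"] by simp
  then show "emeasure (distr lborel borel ((*) c)) (box l u) = (\<Prod>b\<in>Basis. (u - l) \<bullet> b)"
    using le by (subst emeasure_distr) (auto simp: S_def emeasure_lborel_box_eq)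
qed simp

section \<open>Mean values over rotation invariant sets\<close>

lemma set_integral_power_eq_0:
  fixes A :: "complex set"
  assumes A: "A \<in> sets borel" and rot: "\<And>c z. cmod c = 1 \<Longrightarrow> c * z \<in> A \<longleftrightarrow> z \<in> A" and n: "n > 0"
  shows "(LINT z:A|lborel. z ^ n) = 0"
proof -
  \<comment> \<open>Rotation by \<open>c\<close> preserves the set and the measure but, as c^n = -1,
    reverses the sign of the integrand.\<close>
  define c where "c = cis (pi / real n)"
  have cn: "c ^ n = -1"
    using n by (simp add: c_def Complex.DeMoivre cis_pi)
  have c1: "cmod c = 1" by (simp add: c_def)
  let ?f = "\<lambda>z::complex. indicator A z *\<^sub>R z ^ n"
  have "integral\<^sup>L lborel ?f = integral\<^sup>L (distr lborel borel ((*) c)) ?f"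
    by (simp add: lborel_distr_mult_unit c1)
  also have "\<dots> = (\<integral>z. ?f (c * z) \<partial>lborel)"
    using A by (intro integral_distr) auto
  also have "\<dots> = (\<integral>z. - ?f z \<partial>lborel)"
    by (intro Bochner_Integration.integral_cong) (auto simp: rot c1 cn power_mult_distrib indicator_def)
  finally show ?thesis
    by (simp add: set_lebesgue_integral_def)
qed

text \<open>The Taylor series of \<open>F\<close> is integrated term by term over \<open>A\<close>;
  rotation kills all terms but the constant one. The margin \<open>r < R\<close> supplies a summable
  majorant on \<open>A\<close>.\<close>

lemma set_integral_holomorphic_mean_value:
  fixes A :: "complex set"
  assumes A: "A \<in> sets borel" and rot: "\<And>c z. cmod c = 1 \<Longrightarrow> c * z \<in> A \<longleftrightarrow> z \<in> A"
    and r: "r < R" "A \<subseteq> cball 0 r" and F: "F holomorphic_on ball 0 R"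
  shows "(LINT z:A|lborel. F z) = measure lborel A *\<^sub>R F 0"
proof (cases "A = {}")
  case False
  then have r0: "r \<ge> 0" using r by force
  define b where "b n = (deriv ^^ n) F 0 / fact n" for n
  define s where "s = (r + R) / 2"
  have s: "r < s" "s < R" using r by (auto simp: s_def)
  have sums: "(\<lambda>n. b n * z ^ n) sums F z" if "z \<in> ball 0 R" for z
    using holomorphic_power_series[OF F that] by (simp add: b_def)
  have "summable (\<lambda>n. b n * of_real s ^ n)"
    using sums[of "of_real s"] s r0 by (auto simp: sums_iff)
  then have abs_r: "summable (\<lambda>n. cmod (b n) * r ^ n)"
    using powser_insidea[of b "of_real s" "of_real r"] s r0 by (simp add: norm_mult norm_power)
  have fin: "emeasure lborel A < \<infinity>"
    using emeasure_mono[OF r(2), of lborel] r0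
    by (auto simp: emeasure_cball intro: order.strict_trans1)
  have bound: "cmod (b n * z ^ n) \<le> cmod (b n) * r ^ n" if "z \<in> A" for n z
    using that r(2) by (auto simp: norm_mult norm_power intro!: mult_left_mono power_mono)
  have int: "integrable lborel (\<lambda>z. indicator A z *\<^sub>R (b n * z ^ n))" for n
    using A fin bound by (intro integrableI_bounded_set_indicator[where B = "cmod (b n) * r ^ n"]) auto
  have intA: "integrable lborel (\<lambda>z. indicator A z :: real)"
    using A fin by simp
  have le: "(\<integral>z. norm (indicator A z *\<^sub>R (b n * z ^ n)) \<partial>lborel) \<le> (cmod (b n) * r ^ n) * measure lborel A" for n
  proof -
    have "(\<integral>z. norm (indicator A z *\<^sub>R (b n * z ^ n)) \<partial>lborel) \<le> (\<integral>z. (cmod (b n) * r ^ n) * indicator A z \<partial>lborel)"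
      using intA bound by (intro integral_mono integrable_norm int) (auto simp: indicator_def)
    then show ?thesis using A by simp
  qed
  have "(\<lambda>n. \<integral>z. indicator A z *\<^sub>R (b n * z ^ n) \<partial>lborel) sums (\<integral>z. (\<Sum>n. indicator A z *\<^sub>R (b n * z ^ n)) \<partial>lborel)"
  proof (rule sums_integral)
    show "AE z in lborel. summable (\<lambda>n. norm (indicator A z *\<^sub>R (b n * z ^ n)))"
      using bound by (intro AE_I2 summable_comparison_test'[OF abs_r]) (auto simp: indicator_def r0)
    show "summable (\<lambda>n. \<integral>z. norm (indicator A z *\<^sub>R (b n * z ^ n)) \<partial>lborel)"
      by (rule summable_comparison_test'[OF summable_mult2[OF abs_r, of "measure lborel A"]]) (use le in auto)
  qed (rule int)
  moreover have "(\<integral>z. indicator A z *\<^sub>R (b n * z ^ n) \<partial>lborel) = (if n = 0 then measure lborel A *\<^sub>R F 0 else 0)" for n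
  proof (cases "n = 0")
    case True
    then show ?thesis using A by (simp add: b_def scaleR_conv_of_real)
  next
    case n: False
    have "(\<integral>z. indicator A z *\<^sub>R (b n * z ^ n) \<partial>lborel) = b n * (LINT z:A|lborel. z ^ n)"
      unfolding set_lebesgue_integral_def by (subst integral_mult_right_zero[symmetric]) simp
    then show ?thesis using set_integral_power_eq_0[OF A rot] n by simp
  qed
  moreover have "(\<Sum>n. indicator A z *\<^sub>R (b n * z ^ n)) = indicator A z *\<^sub>R F z" for z
  proof (cases "z \<in> A")
    case True
    then have "z \<in> ball 0 R" using r by auto
    then show ?thesis using sums True by (auto simp: sums_iff)
  qed simp
  ultimately have "(\<lambda>n. if n = 0 then measure lborel A *\<^sub>R F 0 else 0) sums (LINT z:A|lborel. F z)"
    by (simp add: set_lebesgue_integral_def)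
  then show ?thesis
    using sums_unique2 sums_single[of 0 "\<lambda>_. measure lborel A *\<^sub>R F 0"] by metis
qed (simp add: set_lebesgue_integral_def)

subsection \<open>Dyadic annuli\<close>

text \<open>Half-open in the radius, so that the annuli partition the disc; the origin lies in
  \<open>annulus 0\<close>.\<close>

definition annulus :: "nat \<Rightarrow> complex set" where
  "annulus m = {z. 1 - (1/2)^m \<le> cmod z \<and> cmod z < 1 - (1/2)^Suc m}"

lemma annulus_borel [measurable]: "annulus m \<in> sets borel"
  unfolding annulus_def by measurable

lemma annulus_subset: "annulus m \<subseteq> cball 0 (1 - (1/2)^Suc m)" "annulus m \<subseteq> ball 0 1"
  by (auto simp: annulus_def intro: less_le_trans)

lemma annulus_rotate: "cmod c = 1 \<Longrightarrow> c * z \<in> annulus m \<longleftrightarrow> z \<in> annulus m"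
  by (simp add: annulus_def norm_mult)

lemma disjoint_family_annulus: "disjoint_family annulus"
proof -
  have "annulus m \<inter> annulus n = {}" if "m < n" for m n
  proof -
    have "(1/2::real) ^ n \<le> (1/2) ^ Suc m"
      using that by (intro power_decreasing) auto
    then show ?thesis by (auto simp: annulus_def)
  qed
  then show ?thesis
    unfolding disjoint_family_on_def by (metis Int_commute linorder_neqE_nat)
qed

lemma UN_annulus: "(\<Union>m. annulus m) = ball 0 1"
proof
  show "ball 0 1 \<subseteq> (\<Union>m. annulus m)"
  proof
    fix z :: complex assume z: "z \<in> ball 0 1"
    define m where "m = (LEAST m. (1/2)^Suc m < 1 - cmod z)"
    obtain n where "(1/2)^n < 1 - cmod z"
      using z real_arch_pow_inv[of "1 - cmod z" "1/2"] by auto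
    then have "(1/2)^Suc n < 1 - cmod z"
      by (rule le_less_trans[rotated]) simp
    then have 1: "(1/2)^Suc m < 1 - cmod z"
      unfolding m_def by (rule LeastI)
    have 2: "1 - cmod z \<le> (1/2)^m"
    proof (cases m)
      case (Suc k)
      then show ?thesis using not_less_Least[of k "\<lambda>m. (1/2)^Suc m < 1 - cmod z"] by (simp add: m_def)
    qed simp
    show "z \<in> (\<Union>m. annulus m)" using 1 2 by (auto simp: annulus_def intro!: exI[of _ m])
  qed
qed (use annulus_subset in auto)

lemma measure_annulus: "measure lborel (annulus m) = pi * ((1 - (1/2)^Suc m)\<^sup>2 - (1 - (1/2)^m)\<^sup>2)"
proof -
  have p: "(1/2::real)^m \<le> 1" "(1/2::real)^Suc m \<le> (1/2)^m" by (auto simp: power_le_one)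
  have eq: "annulus m = ball 0 (1 - (1/2)^Suc m) - ball 0 (1 - (1/2)^m)"
    using zero_less_power[of "1/2::real" m] by (auto simp: annulus_def)
  show ?thesis
    unfolding eq using p
    by (subst measure_Diff)
       (auto simp: content_ball unit_ball_vol_2 algebra_simps emeasure_ball intro!: subset_ball)
qed

lemma emeasure_annulus: "emeasure lborel (annulus m) = ennreal (measure lborel (annulus m))"
proof -
  have "emeasure lborel (annulus m) \<le> emeasure lborel (ball (0::complex) 1)"
    using annulus_subset by (intro emeasure_mono) auto
  then show ?thesis by (intro emeasure_eq_ennreal_measure) (auto simp: emeasure_ball top_unique)
qed

text \<open>With x = (1/2)^m the area is exactly pi (x - 3x^2/4), where 0 < x <= 1.\<close>

lemma measure_annulus_bounds:
  "measure lborel (annulus m) \<le> pi * (1/2)^m" "pi/4 * (1/2)^m \<le> measure lborel (annulus m)"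
proof -
  define x where "x = (1/2::real)^m"
  have x: "0 < x" "x \<le> 1" by (auto simp: x_def power_le_one)
  have "measure lborel (annulus m) = pi * (x - 3/4 * x * x)"
    by (simp add: measure_annulus x_def power2_eq_square algebra_simps)
  moreover have "x - 3/4 * x * x \<le> x" "x / 4 \<le> x - 3/4 * x * x"
    using x mult_right_mono[of x 1 x] by auto
  ultimately show "measure lborel (annulus m) \<le> pi * (1/2)^m" "pi/4 * (1/2)^m \<le> measure lborel (annulus m)"
    unfolding x_def[symmetric] using mult_left_mono[of _ _ pi] by fastforce+
qed

subsection \<open>Rudin--Shapiro polynomials\<close>

text \<open>Powers of two fit the dyadic annuli, and the quadratic exponent makes the ratio 2^(2k+3)
  of consecutive values unbounded. The shift by one ensures \<open>expo k \<ge> 2\<close>.\<close>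

definition expo :: "nat \<Rightarrow> nat" where
  "expo k = 2 ^ (Suc k)\<^sup>2"

lemma expo_ge_2: "expo k \<ge> 2"
  using power_increasing[of 1 "(Suc k)\<^sup>2" "2::nat"] by (simp add: expo_def)

lemma expo_Suc: "expo (Suc k) = 2 ^ (2 * k + 3) * expo k"
proof -
  have "(Suc (Suc k))\<^sup>2 = (2 * k + 3) + (Suc k)\<^sup>2"
    by (simp add: power2_eq_square algebra_simps)
  then show ?thesis by (simp only: expo_def power_add)
qed

lemma expo_ge: "k \<le> expo k"
proof -
  have "k \<le> (Suc k)\<^sup>2" by (simp add: power2_eq_square)
  also have "\<dots> < expo k" by (simp add: expo_def)
  finally show ?thesis by simp
qed

text \<open>The recursion below yields weighted analogues of Golay complementary pairs. Square
  summability bounds the product of the factors 1 + a_k^2; \<open>a k \<le> 1\<close> lets the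
  coefficient be dropped from error terms.\<close>

locale golay =
  fixes a :: "nat \<Rightarrow> real"
  assumes a_nonneg: "0 \<le> a k" and a_le_1: "a k \<le> 1" and a_sq: "summable (\<lambda>k. (a k)\<^sup>2)"
begin

text \<open>\<open>Ps\<close> and \<open>Qs\<close> are the reversed polynomials \<open>z\<^sup>d P(1/z)\<close> and \<open>z\<^sup>d Q(1/z)\<close>, where \<open>d\<close> is
  the sum of the exponents used so far; all coefficients are real, so on the unit circle they equal
  \<open>z\<^sup>d cnj (P z)\<close> and \<open>z\<^sup>d cnj (Q z)\<close>.\<close>
fun P Q Ps Qs :: "nat \<Rightarrow> complex \<Rightarrow> complex" where
  "P 0 z = 0"
| "P (Suc k) z = P k z + of_real (a k) * z ^ expo k * Qs k z"
| "Q 0 z = 1"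
| "Q (Suc k) z = Q k z - of_real (a k) * z ^ expo k * Ps k z"
| "Ps 0 z = 0"
| "Ps (Suc k) z = z ^ expo k * Ps k z + of_real (a k) * Q k z"
| "Qs 0 z = 1"
| "Qs (Suc k) z = z ^ expo k * Qs k z - of_real (a k) * P k z"

text \<open>Since 1 + x <= exp x, the square of \<open>M\<close> dominates every partial product of
  the 1 + a_j^2; so \<open>M\<close> bounds all four families on the closed disc.\<close>

definition M :: real where
  "M = sqrt (exp (\<Sum>k. (a k)\<^sup>2))"

lemma M_ge_1: "M \<ge> 1"
  using suminf_nonneg[OF a_sq] by (simp add: M_def)

lemma P_eq_sum:
  fixes z :: complex
  shows "P n z = (\<Sum>k<n. a k * z ^ expo k * Qs k z)"
  by (induction n) auto

text \<open>Each term added to \<open>Q\<close> carries a positive power of z. The value 1 later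
  makes the mean value bound independent of \<open>k\<close>.\<close>

lemma Q_0: "Q k 0 = 1"
proof (induction k)
  case (Suc k)
  have "expo k \<noteq> 0" using expo_ge_2[of k] by simp
  with Suc show ?case by simp
qed simp

text \<open>On the circle cnj z inverts z, so multiplying the conjugated recursion by z^(expo k + d)
  yields the recursion of the reversed pair. The same \<open>d\<close> must serve both polynomials
  for the cross terms in the energy to cancel.\<close>

lemma reversed_on_circle:
  assumes z: "cmod z = 1"
  shows "\<exists>d. Qs k z = z ^ d * cnj (Q k z) \<and> Ps k z = z ^ d * cnj (P k z)"
proof (induction k)
  case 0
  show ?case by (rule exI[of _ 0]) simp
next
  case (Suc k)
  then obtain d where d: "Qs k z = z ^ d * cnj (Q k z)" "Ps k z = z ^ d * cnj (P k z)" by blast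
  have inv: "z ^ n * cnj z ^ n = 1" for n
    using z by (simp flip: power_mult_distrib complex_norm_square)
  have "z ^ (expo k + d) * (cnj z ^ expo k * (cnj z ^ d * w)) = w" for w
    using inv[of d] inv[of "expo k"] by (simp add: power_add mult_ac)
  then show ?case
    by (intro exI[of _ "expo k + d"]) (simp add: d algebra_simps power_add)
qed

text \<open>The cross terms 2 c Re (u cnj p cnj q) enter the two squares with opposite
  signs.\<close>

lemma energy_step:
  assumes "cmod u = 1"
  shows "(cmod (p + of_real c * u * cnj q))\<^sup>2 + (cmod (q - of_real c * u * cnj p))\<^sup>2
    = (1 + c\<^sup>2) * ((cmod p)\<^sup>2 + (cmod q)\<^sup>2)"
proof -
  have u: "u * cnj u = 1"
    using assms by (simp flip: complex_norm_square)
  have "complex_of_real ((cmod (p + of_real c * u * cnj q))\<^sup>2 + (cmod (q - of_real c * u * cnj p))\<^sup>2)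
      = p * cnj p + q * cnj q + of_real c ^ 2 * (u * cnj u) * (p * cnj p + q * cnj q)"
    unfolding of_real_add complex_norm_square by (simp add: algebra_simps power2_eq_square)
  also have "\<dots> = complex_of_real ((1 + c\<^sup>2) * ((cmod p)\<^sup>2 + (cmod q)\<^sup>2))"
    unfolding u of_real_mult of_real_add complex_norm_square by (simp add: algebra_simps)
  finally show ?thesis by (simp only: of_real_eq_iff)
qed

lemma energy:
  assumes z: "cmod z = 1"
  shows "(cmod (P k z))\<^sup>2 + (cmod (Q k z))\<^sup>2 = (\<Prod>j<k. 1 + (a j)\<^sup>2)"
proof (induction k)
  case (Suc k)
  obtain d where d: "Qs k z = z ^ d * cnj (Q k z)" "Ps k z = z ^ d * cnj (P k z)"
    using reversed_on_circle[OF z] by blast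
  have "cmod (z ^ expo k * z ^ d) = 1"
    using z by (simp add: norm_mult norm_power)
  from energy_step[OF this, of "P k z" "a k" "Q k z"] show ?case
    by (simp add: d Suc.IH mult_ac)
qed simp

lemma circle_bounds:
  assumes z: "cmod z = 1"
  shows "cmod (P k z) \<le> M" "cmod (Q k z) \<le> M" "cmod (Ps k z) \<le> M" "cmod (Qs k z) \<le> M"
    "cmod (Qs k z) = cmod (Q k z)"
proof -
  have "(\<Prod>j<k. 1 + (a j)\<^sup>2) \<le> (\<Prod>j<k. exp ((a j)\<^sup>2))"
    by (intro prod_mono) auto
  also have "\<dots> = exp (\<Sum>j<k. (a j)\<^sup>2)"
    by (simp add: exp_sum)
  also have "\<dots> \<le> M\<^sup>2"
    using sum_le_suminf[OF a_sq, of "{..<k}"] by (simp add: M_def)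
  finally have *: "(cmod (P k z))\<^sup>2 + (cmod (Q k z))\<^sup>2 \<le> M\<^sup>2"
    by (simp add: energy z)
  show PQ: "cmod (P k z) \<le> M" "cmod (Q k z) \<le> M"
    using * M_ge_1 zero_le_power2[of "cmod (P k z)"] zero_le_power2[of "cmod (Q k z)"]
    by (rule_tac power2_le_imp_le[of _ M]; linarith)+
  obtain d where d: "Qs k z = z ^ d * cnj (Q k z)" "Ps k z = z ^ d * cnj (P k z)"
    using reversed_on_circle[OF z] by blast
  show "cmod (Ps k z) \<le> M" "cmod (Qs k z) \<le> M" "cmod (Qs k z) = cmod (Q k z)"
    using PQ z by (simp_all add: d norm_mult norm_power)
qed

section \<open>Holomorphy and uniform bounds on the closed disc\<close>

lemma recursion:
  "P 0 = (\<lambda>z::complex. 0)" "Q 0 = (\<lambda>z::complex. 1)" "Ps 0 = (\<lambda>z::complex. 0)" "Qs 0 = (\<lambda>z::complex. 1)"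
  "P (Suc k) = (\<lambda>z::complex. P k z + a k * z ^ expo k * Qs k z)"
  "Q (Suc k) = (\<lambda>z::complex. Q k z - a k * z ^ expo k * Ps k z)"
  "Ps (Suc k) = (\<lambda>z::complex. z ^ expo k * Ps k z + a k * Q k z)"
  "Qs (Suc k) = (\<lambda>z::complex. z ^ expo k * Qs k z - a k * P k z)"
  by (rule ext, simp)+

lemma entire: "P k holomorphic_on A" "Q k holomorphic_on A" "Ps k holomorphic_on A" "Qs k holomorphic_on A"
proof -
  have "P k holomorphic_on A \<and> Q k holomorphic_on A \<and> Ps k holomorphic_on A \<and> Qs k holomorphic_on A"
  proof (induction k)
    case 0
    show ?case unfolding recursion by (intro conjI holomorphic_intros)
  next
    case (Suc k)
    have "(\<lambda>z. z ^ expo k) holomorphic_on A" "(\<lambda>z. of_real (a k) * z ^ expo k) holomorphic_on A"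
      by (intro holomorphic_intros)+
    with Suc show ?case
      unfolding recursion by (auto intro!: holomorphic_on_add holomorphic_on_diff holomorphic_on_mult)
  qed
  then show "P k holomorphic_on A" "Q k holomorphic_on A" "Ps k holomorphic_on A" "Qs k holomorphic_on A"
    by auto
qed

lemma max_modulus_cball:
  assumes "F holomorphic_on UNIV" "\<And>z. cmod z = 1 \<Longrightarrow> cmod (F z) \<le> B" "cmod z \<le> 1"
  shows "cmod (F z) \<le> B"
proof (rule maximum_modulus_frontier[of F "cball 0 1"])
  show "F holomorphic_on interior (cball 0 1)"
    using assms(1) by (rule holomorphic_on_subset) simp
  show "continuous_on (closure (cball 0 1)) F"
    using holomorphic_on_subset[OF assms(1)] by (intro holomorphic_on_imp_continuous_on) simp
qed (use assms(2,3) in auto)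

lemma disc_bounds:
  assumes "cmod z \<le> 1"
  shows "cmod (P k z) \<le> M" "cmod (Q k z) \<le> M" "cmod (Ps k z) \<le> M" "cmod (Qs k z) \<le> M"
  by (rule max_modulus_cball[OF _ _ assms], rule entire, erule circle_bounds)+


section \<open>Derivative bounds for the four polynomial families\<close>

lemma has_derivs:
  "(P k has_field_derivative deriv (P k) z) (at z within A)"
  "(Q k has_field_derivative deriv (Q k) z) (at z within A)"
  "(Ps k has_field_derivative deriv (Ps k) z) (at z within A)"
  "(Qs k has_field_derivative deriv (Qs k) z) (at z within A)"
  by (rule holomorphic_derivI[of _ UNIV], rule entire, simp_all)+

lemma deriv_Suc:
  fixes z :: complex
  shows
  "deriv (P (Suc k)) z = deriv (P k) z
     + a k * (expo k * z ^ (expo k - 1) * Qs k z + z ^ expo k * deriv (Qs k) z)"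
  "deriv (Q (Suc k)) z = deriv (Q k) z
     - a k * (expo k * z ^ (expo k - 1) * Ps k z + z ^ expo k * deriv (Ps k) z)"
  "deriv (Ps (Suc k)) z = expo k * z ^ (expo k - 1) * Ps k z + z ^ expo k * deriv (Ps k) z
     + a k * deriv (Q k) z"
  "deriv (Qs (Suc k)) z = expo k * z ^ (expo k - 1) * Qs k z + z ^ expo k * deriv (Qs k) z
     - a k * deriv (P k) z"
  unfolding recursion
  by (rule DERIV_imp_deriv, (rule derivative_eq_intros has_derivs refl)+, simp add: algebra_simps)+

text \<open>The exponents grow so fast that the crude recursion \<open>D\<^sub>k\<^sub>+\<^sub>1 \<ge> 2 D\<^sub>k + M expo k\<close>, which needs no
  Bernstein inequality, still gives derivative bounds that are small compared with \<open>expo k\<close>.\<close>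
definition D :: "nat \<Rightarrow> real" where
  "D k = M * expo k / 2 ^ k"

lemma D_nonneg: "0 \<le> D k"
  using M_ge_1 by (simp add: D_def)

text \<open>The growth factor 2^(2k+3) of \<open>expo\<close>, divided by 2^(k+1), gives D (Suc k) =
  2^(k+2) M expo k, while the left side is at most 3 M expo k.\<close>

lemma D_Suc: "2 * D k + M * expo k \<le> D (Suc k)"
proof -
  have "2 / 2 ^ k + 1 \<le> (3::real)"
    by (simp add: field_simps)
  also have "3 \<le> (2::real) ^ (k + 2)"
    using one_le_power[of "2::real" k] by (simp add: power_add del: one_le_power)
  finally have "(2 / 2 ^ k + 1) * (M * expo k) \<le> 2 ^ (k + 2) * (M * expo k)"
    using M_ge_1 by (intro mult_right_mono) auto
  moreover have "(2::real) ^ (2 * k + 3) = 2 ^ (k + 2) * 2 ^ Suc k"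
    unfolding power_add[symmetric] by (rule arg_cong[where f = "(^) 2"]) simp
  then have "D (Suc k) = 2 ^ (k + 2) * (M * expo k)"
    unfolding D_def expo_Suc of_nat_mult of_nat_power of_nat_numeral by simp
  ultimately show ?thesis
    by (simp add: D_def algebra_simps)
qed

text \<open>One estimate for the four recursions: \<open>x\<close> is the polynomial multiplied by
  the power of z, \<open>x'\<close> its derivative and \<open>y'\<close> the derivative of the other
  polynomial.\<close>

lemma step_bounds:
  fixes z x x' y' :: complex
  assumes z: "cmod z \<le> 1" and x: "cmod x \<le> M" and x': "cmod x' \<le> D k" and y': "cmod y' \<le> D k"
  shows "cmod (y' + a k * (expo k * z ^ (expo k - 1) * x + z ^ expo k * x')) \<le> D (Suc k)"
    "cmod (y' - a k * (expo k * z ^ (expo k - 1) * x + z ^ expo k * x')) \<le> D (Suc k)"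
    "cmod (expo k * z ^ (expo k - 1) * x + z ^ expo k * x' + a k * y') \<le> D (Suc k)"
    "cmod (expo k * z ^ (expo k - 1) * x + z ^ expo k * x' - a k * y') \<le> D (Suc k)"
proof -
  let ?t = "expo k * z ^ (expo k - 1) * x + z ^ expo k * x'"
  have zn: "cmod z ^ n \<le> 1" for n
    using z by (simp add: power_le_one)
  have "cmod (expo k * z ^ (expo k - 1) * x) \<le> expo k * 1 * M"
    unfolding norm_mult norm_power norm_of_nat using zn x by (intro mult_mono) (auto intro: mult_left_le)
  moreover have "cmod (z ^ expo k * x') \<le> 1 * D k"
    unfolding norm_mult norm_power using zn x' by (intro mult_mono) auto
  ultimately have t: "cmod ?t \<le> M * expo k + D k"
    using norm_triangle_ineq[of "expo k * z ^ (expo k - 1) * x" "z ^ expo k * x'"] by (simp add: mult.commute)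
  have a1: "cmod (a k * w) \<le> cmod w" for w :: complex
    using a_nonneg[of k] a_le_1[of k] by (simp add: norm_mult mult_left_le_one_le)
  note * = D_Suc[of k] t y' a1[of ?t] a1[of y']
  show "cmod (y' + a k * ?t) \<le> D (Suc k)"
    using * norm_triangle_ineq[of y' "a k * ?t"] by linarith
  show "cmod (y' - a k * ?t) \<le> D (Suc k)"
    using * norm_triangle_ineq4[of y' "a k * ?t"] by linarith
  show "cmod (?t + a k * y') \<le> D (Suc k)"
    using * norm_triangle_ineq[of ?t "a k * y'"] by linarith
  show "cmod (?t - a k * y') \<le> D (Suc k)"
    using * norm_triangle_ineq4[of ?t "a k * y'"] by linarith
qed

lemma deriv_bounds:
  assumes z: "cmod z \<le> 1"
  shows "cmod (deriv (P k) z) \<le> D k" "cmod (deriv (Q k) z) \<le> D k"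
    "cmod (deriv (Ps k) z) \<le> D k" "cmod (deriv (Qs k) z) \<le> D k"
proof -
  have "cmod (deriv (P k) z) \<le> D k \<and> cmod (deriv (Q k) z) \<le> D k
    \<and> cmod (deriv (Ps k) z) \<le> D k \<and> cmod (deriv (Qs k) z) \<le> D k"
  proof (induction k)
    case 0
    show ?case unfolding recursion by (simp add: D_nonneg)
  next
    case (Suc k)
    show ?case
      unfolding deriv_Suc
      by (intro conjI; rule step_bounds; use Suc disc_bounds[OF z] z in simp)
  qed
  then show "cmod (deriv (P k) z) \<le> D k" "cmod (deriv (Q k) z) \<le> D k"
    "cmod (deriv (Ps k) z) \<le> D k" "cmod (deriv (Qs k) z) \<le> D k" by auto
qed

lemma lipschitz_disc:
  assumes "\<And>z. cmod z \<le> 1 \<Longrightarrow> (F has_field_derivative F' z) (at z within cball 0 1)"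
    and "\<And>z. cmod z \<le> 1 \<Longrightarrow> cmod (F' z) \<le> B" and "cmod z \<le> 1" "cmod w \<le> 1"
  shows "cmod (F z - F w) \<le> B * cmod (z - w)"
  using assms
  by (intro field_differentiable_bound[of "cball 0 1" F F' B]) auto

text \<open>The moduli agree on the unit circle, and moving radially from \<open>z\<close> to the
  circle changes each polynomial by at most D k (1 - |z|).\<close>

lemma Qs_near_Q:
  fixes z :: complex
  assumes z: "cmod z \<le> 1" "z \<noteq> 0"
  shows "cmod (Q k z) - cmod (Qs k z) \<le> 2 * D k * (1 - cmod z)"
proof -
  define u where "u = z / cmod z"
  have u: "cmod u = 1" using z by (simp add: u_def norm_divide)
  have "z - u = - (of_real (1 - cmod z) * u)"
    using z by (simp add: u_def field_simps)
  then have zu: "cmod (z - u) = 1 - cmod z"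
    using z u by (simp only: norm_mult norm_minus_cancel norm_of_real) simp
  have 1: "cmod (Q k z - Q k u) \<le> D k * cmod (z - u)"
    using z u by (intro lipschitz_disc[where F' = "deriv (Q k)"] has_derivs deriv_bounds) auto
  have 2: "cmod (Qs k z - Qs k u) \<le> D k * cmod (z - u)"
    using z u by (intro lipschitz_disc[where F' = "deriv (Qs k)"] has_derivs deriv_bounds) auto
  show ?thesis
    using 1 2 circle_bounds(5)[OF u, of k] norm_triangle_ineq3[of "Q k z" "Q k u"]
      norm_triangle_ineq3[of "Qs k z" "Qs k u"] by (simp add: zu)
qed

text \<open>Differentiating the power gives the main term; the term with the derivative of
  \<open>Qs k\<close> obeys the same bound because D k <= M expo k.\<close>

lemma block_deriv_bound:
  fixes z :: complex
  assumes z: "cmod z \<le> 1"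
  shows "cmod (deriv (P (Suc k)) z - deriv (P k) z) \<le> 2 * M * a k * (expo k * cmod z ^ (expo k - 1))"
proof -
  have M: "M \<ge> 1" by (rule M_ge_1)
  have 1: "cmod (expo k * z ^ (expo k - 1) * Qs k z) \<le> expo k * cmod z ^ (expo k - 1) * M"
    unfolding norm_mult norm_power norm_of_nat using disc_bounds[OF z] by (intro mult_mono) auto
  have "D k \<le> M * expo k"
    using M mult_left_mono[of 1 "2 ^ k" "M * expo k"] by (simp add: D_def field_simps)
  then have "cmod (z ^ expo k * deriv (Qs k) z) \<le> cmod z ^ (expo k - 1) * (M * expo k)"
    unfolding norm_mult norm_power using deriv_bounds[OF z, of k] z
    by (intro mult_mono power_decreasing) auto
  with 1 have "cmod (expo k * z ^ (expo k - 1) * Qs k z + z ^ expo k * deriv (Qs k) z)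
      \<le> 2 * M * (expo k * cmod z ^ (expo k - 1))"
    by (intro norm_triangle_le) (simp add: mult_ac)
  then have "a k * cmod (expo k * z ^ (expo k - 1) * Qs k z + z ^ expo k * deriv (Qs k) z)
      \<le> a k * (2 * M * (expo k * cmod z ^ (expo k - 1)))"
    by (intro mult_left_mono a_nonneg)
  then show ?thesis
    by (simp add: deriv_Suc norm_mult a_nonneg mult_ac)
qed

end

subsection \<open>The limit function\<close>

lemma power_decay_bound:
  fixes t :: real
  assumes t: "0 < t" "t \<le> 1" and n: "n \<ge> 2"
  shows "t * (n * (1 - t) ^ (n - 1)) \<le> 8 / (t * n)"
proof -
  \<comment> \<open>As n >= 2, the exponent t (n - 1) is at least \<open>y\<close>; then exp y >=
    y^2/2 turns exponential decay into a reciprocal power.\<close>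
  define y where "y = t * n / 2"
  have y: "y > 0" using t n by (simp add: y_def)
  have "(1 - t) ^ (n - 1) \<le> exp (- t) ^ (n - 1)"
    using t exp_ge_add_one_self[of "-t"] by (intro power_mono) auto
  also have "\<dots> = exp (- (t * (n - 1)))"
    by (simp flip: exp_of_nat_mult add: mult.commute)
  also have "\<dots> \<le> exp (- y)"
    using t n by (simp add: y_def of_nat_diff field_simps)
  also have "\<dots> \<le> 1 / (y\<^sup>2 / 2)"
  proof -
    have "y\<^sup>2 / 2 \<le> exp y"
      using exp_lower_Taylor_quadratic[of y] y by linarith
    then show ?thesis
      using y unfolding exp_minus inverse_eq_divide by (intro divide_left_mono) auto
  qed
  finally have "t * n * (1 - t) ^ (n - 1) \<le> t * n * (1 / (y\<^sup>2 / 2))"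
    using t by (intro mult_left_mono) auto
  also have "\<dots> = 8 / (t * n)"
    using t n by (simp add: y_def power2_eq_square field_simps)
  finally show ?thesis by (simp add: mult.assoc)
qed

lemma geometric_sum_le:
  fixes x :: real
  assumes x: "0 \<le> x" "x < 1" and "finite S" "inj_on g S"
  shows "(\<Sum>n\<in>S. x ^ g n) \<le> 1 / (1 - x)"
proof -
  have "(\<Sum>n\<in>S. x ^ g n) = (\<Sum>i\<in>g ` S. x ^ i)"
    using assms by (simp add: sum.reindex)
  also have "\<dots> \<le> (\<Sum>i. x ^ i)"
    using assms by (intro sum_le_suminf summable_geometric) auto
  finally show ?thesis
    using x by (simp add: suminf_geometric)
qed

text \<open>With truncated subtraction one of the two differences is always 0, so splitting at
  \<open>m\<close> leaves two one-sided geometric sums.\<close>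

lemma two_sided_geometric_sum_le:
  fixes x :: real and m :: nat
  assumes x: "0 \<le> x" "x < 1" and S: "finite S"
  shows "(\<Sum>n\<in>S. x ^ ((m - n) + (n - m))) \<le> 2 / (1 - x)"
proof -
  have "(\<Sum>n\<in>S. x ^ ((m - n) + (n - m)))
      = (\<Sum>n\<in>S \<inter> {..m}. x ^ ((m - n) + (n - m))) + (\<Sum>n\<in>S - {..m}. x ^ ((m - n) + (n - m)))"
    by (rule sum.Int_Diff[OF S])
  also have "\<dots> = (\<Sum>n\<in>S \<inter> {..m}. x ^ (m - n)) + (\<Sum>n\<in>S - {..m}. x ^ (n - m))"
    by (intro arg_cong2[where f = "(+)"] sum.cong) auto
  also have "\<dots> \<le> 1 / (1 - x) + 1 / (1 - x)"
    using x S by (intro add_mono geometric_sum_le) (auto simp: inj_on_def)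
  finally show ?thesis by simp
qed

text \<open>On annulus \<open>m\<close> we have \<open>1 - |z| \<approx> 2\<^sup>-\<^sup>m\<close>, and \<open>expo j = 2\<^bsup>(j+1)\<^sup>2\<^esup>\<close>: block \<open>j\<close> lives on annulus
  \<open>(j+1)\<^sup>2\<close>. The truncated differences add up to \<open>|m - (j+1)\<^sup>2|\<close>.\<close>
definition gap :: "nat \<Rightarrow> nat \<Rightarrow> nat" where
  "gap m j = (m - (Suc j)\<^sup>2) + ((Suc j)\<^sup>2 - m)"

lemma sum_gap_le:
  fixes x :: real
  assumes x: "0 \<le> x" "x < 1"
  shows "(\<Sum>j<n. x ^ gap m j) \<le> 2 / (1 - x)" "(\<Sum>m<n. x ^ gap m j) \<le> 2 / (1 - x)"
proof -
  have inj: "inj_on (\<lambda>j. (Suc j)\<^sup>2) {..<n}"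
    by (auto simp: inj_on_def power2_eq_iff_nonneg)
  have "(\<Sum>j<n. x ^ gap m j) = (\<Sum>i\<in>(\<lambda>j. (Suc j)\<^sup>2) ` {..<n}. x ^ ((m - i) + (i - m)))"
    by (simp add: sum.reindex[OF inj] gap_def)
  also have "\<dots> \<le> 2 / (1 - x)"
    using x by (intro two_sided_geometric_sum_le) auto
  finally show "(\<Sum>j<n. x ^ gap m j) \<le> 2 / (1 - x)" .
  have "(\<Sum>m<n. x ^ gap m j) = (\<Sum>m<n. x ^ (((Suc j)\<^sup>2 - m) + (m - (Suc j)\<^sup>2)))"
    by (simp add: gap_def add.commute)
  also have "\<dots> \<le> 2 / (1 - x)"
    using x by (intro two_sided_geometric_sum_le) auto
  finally show "(\<Sum>m<n. x ^ gap m j) \<le> 2 / (1 - x)" .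
qed

lemma annulusD:
  assumes "z \<in> annulus m"
  shows "1 - cmod z \<le> (1/2) ^ m" "(1/2) ^ Suc m < 1 - cmod z" "0 < 1 - cmod z" "cmod z < 1"
proof -
  show "1 - cmod z \<le> (1/2) ^ m" and *: "(1/2) ^ Suc m < 1 - cmod z"
    using assms by (auto simp: annulus_def)
  show "0 < 1 - cmod z"
    using * by (rule less_trans[rotated]) simp
  then show "cmod z < 1" by simp
qed

text \<open>Near the circle, N <= m, bounding the power of |z| by 1 suffices. Further inside, the
  decay of that power takes over, and t > (1/2)^(m+1) turns the constant 8 into 16.\<close>

lemma weight_annulus:
  assumes z: "z \<in> annulus m"
  shows "(1 - cmod z) * (expo j * cmod z ^ (expo j - 1)) \<le> 16 * (1/2) ^ gap m j"
proof -
  define t where "t = 1 - cmod z"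
  have t: "t \<le> (1/2) ^ m" "(1/2) ^ Suc m < t" "0 < t" "t \<le> 1"
    using annulusD[OF z] by (simp_all add: t_def)
  define N where "N = (Suc j)\<^sup>2"
  have e: "expo j = 2 ^ N" by (simp add: expo_def N_def)
  have gap: "gap m j = (m - N) + (N - m)" by (simp add: gap_def N_def)
  have "t * (expo j * (1 - t) ^ (expo j - 1)) \<le> 16 * (1/2) ^ gap m j"
  proof (cases "N \<le> m")
    case True
    have "t * (expo j * (1 - t) ^ (expo j - 1)) \<le> (1/2) ^ m * (expo j * 1)"
      using t by (intro mult_mono) (auto intro!: mult_left_le power_le_one)
    also have "\<dots> = (1/2) ^ (m - N)"
      using True by (simp add: e power_diff power_divide)
    also have "\<dots> \<le> 16 * (1/2) ^ gap m j"
      using True by (simp add: gap)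
    finally show ?thesis .
  next
    case False
    have "t * (expo j * (1 - t) ^ (expo j - 1)) \<le> 8 / (t * expo j)"
      using t expo_ge_2 by (intro power_decay_bound)
    also have "\<dots> \<le> 8 / ((1/2) ^ Suc m * expo j)"
      using t expo_ge_2[of j] by (intro divide_left_mono mult_right_mono) auto
    also have "\<dots> = 16 * (1/2) ^ (N - m)"
      using False by (simp add: e power_diff power_divide)
    also have "\<dots> = 16 * (1/2) ^ gap m j"
      using False by (simp add: gap)
    finally show ?thesis .
  qed
  then show ?thesis by (simp add: t_def)
qed

section \<open>Convergence of the series and boundedness of its sum\<close>

context golay
begin

definition f :: "complex \<Rightarrow> complex" where
  "f z = (if z \<in> ball 0 1 then \<Sum>k. of_real (a k) * z ^ expo k * Qs k z else 0)"

text \<open>The partial sums are the \<open>P n\<close>, and the terms are dominated by M r^k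
  because expo k >= k and a_k <= 1.\<close>

lemma uniform_limit_P:
  assumes r: "0 \<le> r" "r < 1"
  shows "uniform_limit (cball 0 r) P f sequentially"
proof -
  have "uniform_limit (cball 0 r) (\<lambda>n z. \<Sum>k<n. of_real (a k) * z ^ expo k * Qs k z)
      (\<lambda>z. \<Sum>k. of_real (a k) * z ^ expo k * Qs k z) sequentially"
  proof (rule Weierstrass_m_test)
    show "summable (\<lambda>k. r ^ k * M)"
      using r by (intro summable_mult2 summable_geometric) auto
    fix k and z :: complex assume "z \<in> cball 0 r"
    then have z: "cmod z \<le> r" by simp
    have "cmod z ^ expo k \<le> r ^ expo k"
      using z by (intro power_mono) auto
    also have "\<dots> \<le> r ^ k"
      using r expo_ge by (intro power_decreasing) auto
    finally have "a k * cmod z ^ expo k \<le> 1 * r ^ k"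
      using a_nonneg a_le_1 by (intro mult_mono) auto
    then show "cmod (of_real (a k) * z ^ expo k * Qs k z) \<le> r ^ k * M"
      unfolding norm_mult norm_power
      using z r disc_bounds(4)[of z k] a_nonneg[of k] by (intro mult_mono) auto
  qed
  then show ?thesis
    by (rule uniform_limit_cong'[THEN iffD1, rotated 2]) (use r in \<open>auto simp: P_eq_sum f_def\<close>)
qed

lemma locally_uniform_limit_P:
  assumes "z \<in> ball 0 1"
  shows "\<exists>d>0. cball z d \<subseteq> ball 0 1 \<and> uniform_limit (cball z d) P f sequentially"
proof (intro exI conjI)
  define d where "d = (1 - cmod z) / 2"
  show d: "d > 0" using assms by (simp add: d_def)
  have sub: "cball z d \<subseteq> cball 0 (cmod z + d)" "cmod z + d < 1"
  proof -
    show "cball z d \<subseteq> cball 0 (cmod z + d)"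
    proof
      fix t assume "t \<in> cball z d"
      then show "t \<in> cball 0 (cmod z + d)"
        using norm_triangle_sub[of t z] by (simp add: dist_norm norm_minus_commute)
    qed
    show "cmod z + d < 1" using assms by (simp add: d_def field_simps)
  qed
  then show "cball z d \<subseteq> ball 0 1" by auto
  show "uniform_limit (cball z d) P f sequentially"
    using sub d by (intro uniform_limit_on_subset[OF uniform_limit_P sub(1)]) auto
qed

lemma holomorphic_f: "f holomorphic_on ball 0 1"
  by (rule holomorphic_uniform_sequence[OF _ entire(1) locally_uniform_limit_P]) simp

lemma analytic_disc_f: "analytic_disc f"
  using holomorphic_f by (simp add: analytic_disc_def f_def)

lemma norm_f_le: "cmod (f z) \<le> M"
proof (cases "z \<in> ball 0 1")
  case True
  then have "(\<lambda>n. P n z) \<longlonglongrightarrow> f z"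
    by (intro tendsto_uniform_limitI[OF uniform_limit_P[of "cmod z"]]) auto
  then show ?thesis
    using True disc_bounds(1) by (intro Lim_norm_ubound[of sequentially "\<lambda>n. P n z"]) auto
qed (use M_ge_1 in \<open>simp add: f_def\<close>)

lemma f_H_infty: "f \<in> H_infty"
  using boundedI[of "f ` ball 0 1" M] norm_f_le analytic_disc_f by (simp add: H_infty_def image_iff) blast

lemma deriv_P_tendsto:
  assumes "z \<in> ball 0 1"
  shows "(\<lambda>n. deriv (P n) z) \<longlonglongrightarrow> deriv f z"
proof -
  have "\<exists>f'. \<forall>x\<in>ball 0 1. (f has_field_derivative f' x) (at x) \<and> (\<lambda>n. deriv (P n) x) \<longlonglongrightarrow> f' x"
    using locally_uniform_limit_P
    by (intro has_complex_derivative_uniform_sequence[of _ P]) (auto intro: has_derivs)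
  then show ?thesis
    using assms DERIV_imp_deriv by metis
qed

text \<open>The difference telescopes into blocks, each bounded by \<open>block_deriv_bound\<close>
  and \<open>weight_annulus\<close>, whence 32 = 2 * 16. It serves as an upper bound for the
  derivative (k = 0) and as a tail estimate.\<close>

lemma deriv_P_diff_bound:
  assumes z: "z \<in> annulus m" and kn: "k \<le> n"
  shows "(1 - cmod z) * cmod (deriv (P n) z - deriv (P k) z) \<le> 32 * M * (\<Sum>j=k..<n. a j * (1/2) ^ gap m j)"
proof -
  have "deriv (P n) z - deriv (P k) z = (\<Sum>j=k..<n. deriv (P (Suc j)) z - deriv (P j) z)"
    by (rule sum_Suc_diff'[OF kn, symmetric])
  then have "(1 - cmod z) * cmod (deriv (P n) z - deriv (P k) z)
      \<le> (1 - cmod z) * (\<Sum>j=k..<n. 2 * M * a j * (expo j * cmod z ^ (expo j - 1)))"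
    using annulusD[OF z] by (auto simp del: One_nat_def intro!: mult_left_mono sum_norm_le block_deriv_bound)
  also have "\<dots> = (\<Sum>j=k..<n. 2 * M * a j * ((1 - cmod z) * (expo j * cmod z ^ (expo j - 1))))"
    by (simp add: sum_distrib_left mult_ac)
  also have "\<dots> \<le> (\<Sum>j=k..<n. 2 * M * a j * (16 * (1/2) ^ gap m j))"
    using a_nonneg M_ge_1 by (intro sum_mono mult_left_mono weight_annulus z) auto
  also have "\<dots> = 32 * M * (\<Sum>j=k..<n. a j * (1/2) ^ gap m j)"
    by (simp add: sum_distrib_left mult_ac)
  finally show ?thesis .
qed

section \<open>Membership of the limit in \<open>Dirichlet_type p\<close>\<close>

definition s :: real where "s = sqrt (1/2)"

text \<open>A geometrically weighted sum of the a_j^p, concentrated on blocks near annulus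
  \<open>m\<close>; up to a constant it bounds the p-th power of (1 - |z|) |f'| there.\<close>

definition T :: "real \<Rightarrow> nat \<Rightarrow> real" where
  "T p m = (\<Sum>j. a j powr p * (s powr p) ^ gap m j)"

lemma s_bounds: "0 < s" "s < 1"
  by (auto simp: s_def)

context
  fixes p :: real
  assumes p: "p > 0" and sum_ap: "summable (\<lambda>j. a j powr p)"
begin

lemma sp_bounds: "0 < s powr p" "s powr p < 1"
  using s_bounds powr_less_mono2[of p s 1] p by auto

lemma summable_T_terms: "summable (\<lambda>j. a j powr p * (s powr p) ^ gap m j)"
proof (rule summable_comparison_test'[OF sum_ap])
  fix j
  show "norm (a j powr p * (s powr p) ^ gap m j) \<le> a j powr p"
    using sp_bounds by (auto simp: abs_mult intro!: mult_left_le power_le_one)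
qed

lemma T_nonneg: "T p m \<ge> 0"
  unfolding T_def using sp_bounds by (intro suminf_nonneg summable_T_terms) auto

text \<open>After exchanging the sums, each a_j^p is multiplied by a geometric sum over annuli of at
  most 2 / (1 - s^p).\<close>

lemma summable_T: "summable (T p)"
proof (rule bounded_imp_summable[OF T_nonneg])
  fix L
  have "(\<Sum>m\<le>L. T p m) = (\<Sum>m<Suc L. T p m)"
    by (simp add: lessThan_Suc_atMost)
  also have "\<dots> = (\<Sum>j. \<Sum>m<Suc L. a j powr p * (s powr p) ^ gap m j)"
    unfolding T_def by (intro suminf_sum[symmetric] summable_T_terms)
  also have "\<dots> = (\<Sum>j. a j powr p * (\<Sum>m<Suc L. (s powr p) ^ gap m j))"
    by (simp only: sum_distrib_left)
  also have "\<dots> \<le> (\<Sum>j. a j powr p * (2 / (1 - s powr p)))"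
  proof (rule suminf_le)
    show "summable (\<lambda>j. a j powr p * (\<Sum>m<Suc L. (s powr p) ^ gap m j))"
      unfolding sum_distrib_left by (intro summable_sum summable_T_terms)
    show "summable (\<lambda>j. a j powr p * (2 / (1 - s powr p)))"
      by (intro summable_mult2 sum_ap)
    show "a j powr p * (\<Sum>m<Suc L. (s powr p) ^ gap m j) \<le> a j powr p * (2 / (1 - s powr p))" for j
      using sp_bounds by (intro mult_left_mono sum_gap_le) auto
  qed
  finally show "(\<Sum>m\<le>L. T p m) \<le> (\<Sum>j. a j powr p * (2 / (1 - s powr p)))" .
qed

text \<open>Splitting \<open>(1/2)^d\<close> as \<open>s^d \<cdot> s^d\<close> and bounding one factor by its supremum
  replaces Hoelder's inequality, uniformly in \<open>p > 0\<close>.\<close>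
lemma sum_le_T: "(\<Sum>j<n. a j * (1/2) ^ gap m j) \<le> T p m powr (1 / p) * (2 / (1 - s))"
proof -
  have half: "(1/2) ^ d = s ^ d * s ^ d" for d
    by (simp add: s_def flip: power_mult_distrib)
  have le: "a j * s ^ gap m j \<le> T p m powr (1 / p)" for j
  proof -
    have "(a j * s ^ gap m j) powr p = a j powr p * (s powr p) ^ gap m j"
      using s_bounds a_nonneg by (simp add: powr_mult powr_powr mult.commute flip: powr_realpow)
    also have "\<dots> \<le> T p m"
      unfolding T_def using sum_le_suminf[OF summable_T_terms, of "{j}" m] sp_bounds by simp
    finally have "((a j * s ^ gap m j) powr p) powr (1 / p) \<le> T p m powr (1 / p)"
      using p by (intro powr_mono2) auto
    then show ?thesis
      using p a_nonneg s_bounds by (simp add: powr_powr)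
  qed
  have "(\<Sum>j<n. a j * (1/2) ^ gap m j) = (\<Sum>j<n. (a j * s ^ gap m j) * s ^ gap m j)"
    by (simp add: half mult.assoc)
  also have "\<dots> \<le> (\<Sum>j<n. T p m powr (1 / p) * s ^ gap m j)"
    using le s_bounds by (intro sum_mono mult_right_mono) auto
  also have "\<dots> = T p m powr (1 / p) * (\<Sum>j<n. s ^ gap m j)"
    by (simp only: sum_distrib_left)
  also have "\<dots> \<le> T p m powr (1 / p) * (2 / (1 - s))"
    using s_bounds by (intro mult_left_mono sum_gap_le) auto
  finally show ?thesis .
qed

definition K :: real where "K = 32 * M * (2 / (1 - s))"

lemma K_nonneg: "K \<ge> 0"
  using M_ge_1 s_bounds by (simp add: K_def)

text \<open>The bound for \<open>P n\<close> is uniform in \<open>n\<close> and passes to the limit;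
  since \<open>P 0\<close> is constant, the difference estimate from block 0 on bounds the whole
  derivative.\<close>

lemma deriv_f_annulus:
  assumes z: "z \<in> annulus m"
  shows "((1 - cmod z) * cmod (deriv f z)) powr p \<le> K powr p * T p m"
proof -
  have "(\<lambda>n. (1 - cmod z) * cmod (deriv (P n) z)) \<longlonglongrightarrow> (1 - cmod z) * cmod (deriv f z)"
    using annulusD[OF z] by (intro tendsto_intros deriv_P_tendsto) auto
  moreover have "(1 - cmod z) * cmod (deriv (P n) z) \<le> K * T p m powr (1 / p)" for n
  proof -
    have "deriv (P 0) z = 0" unfolding recursion by simp
    then have "(1 - cmod z) * cmod (deriv (P n) z) \<le> 32 * M * (\<Sum>j<n. a j * (1/2) ^ gap m j)"
      using deriv_P_diff_bound[OF z, of 0 n] by (simp add: atLeast0LessThan)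
    also have "\<dots> \<le> 32 * M * (T p m powr (1 / p) * (2 / (1 - s)))"
      using M_ge_1 by (intro mult_left_mono sum_le_T) auto
    finally show ?thesis by (simp add: K_def mult_ac)
  qed
  ultimately have "(1 - cmod z) * cmod (deriv f z) \<le> K * T p m powr (1 / p)"
    by (intro LIMSEQ_le_const2) auto
  then have "((1 - cmod z) * cmod (deriv f z)) powr p \<le> (K * T p m powr (1 / p)) powr p"
    using p annulusD[OF z] by (intro powr_mono2) auto
  also have "\<dots> = K powr p * T p m"
    using p K_nonneg T_nonneg by (simp add: powr_mult powr_powr)
  finally show ?thesis .
qed

lemma f_Dirichlet: "f \<in> Dirichlet_type p"
proof -
  \<comment> \<open>The weight leaves a factor 1/(1 - |z|) <= 2^(m+1) on annulus \<open>m\<close>.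
    The area, at most pi / 2^m, cancels its growth and leaves 2 K^p T p m.\<close>
  define c where "c m = 2 / pi * 2 ^ m * (K powr p * T p m)" for m
  have c0: "c m \<ge> 0" for m using T_nonneg by (simp add: c_def)
  let ?h = "\<lambda>z. (1 / pi) * (1 - cmod z) powr (p - 1) * cmod (deriv f z) powr p"
  have h: "?h z \<le> c m" if z: "z \<in> annulus m" for z m
  proof -
    note t = annulusD[OF z]
    have "?h z = (1 / pi) * ((1 / (1 - cmod z)) * ((1 - cmod z) * cmod (deriv f z)) powr p)"
      using t by (simp add: powr_diff powr_mult)
    also have "\<dots> \<le> (1 / pi) * ((1 / (1/2) ^ Suc m) * (K powr p * T p m))"
      using t T_nonneg by (intro mult_left_mono mult_mono divide_left_mono deriv_f_annulus z) (auto simp del: power_Suc)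
    finally show ?thesis by (simp add: c_def power_divide)
  qed
  have le_suminf: "g m \<le> (\<Sum>i. g i)" for g :: "nat \<Rightarrow> ennreal" and m
    using sum_le_suminf[of g "{m}"] by simp
  have "(\<integral>\<^sup>+ z \<in> ball 0 1. ennreal (?h z) \<partial>lborel) \<le> (\<integral>\<^sup>+ z. (\<Sum>m. ennreal (c m) * indicator (annulus m) z) \<partial>lborel)"
  proof (rule nn_integral_mono)
    fix z :: complex
    show "ennreal (?h z) * indicator (ball 0 1) z \<le> (\<Sum>m. ennreal (c m) * indicator (annulus m) z)"
    proof (cases "z \<in> ball 0 1")
      case True
      then obtain m where m: "z \<in> annulus m" using UN_annulus by blast
      then have "ennreal (?h z) * indicator (ball 0 1) z \<le> ennreal (c m) * indicator (annulus m) z"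
        using True h by (simp add: ennreal_leI)
      also have "\<dots> \<le> (\<Sum>m. ennreal (c m) * indicator (annulus m) z)"
        by (rule le_suminf)
      finally show ?thesis .
    qed simp
  qed
  also have "\<dots> = (\<Sum>m. \<integral>\<^sup>+ z. ennreal (c m) * indicator (annulus m) z \<partial>lborel)"
    by (intro nn_integral_suminf) auto
  also have "\<dots> = (\<Sum>m. ennreal (c m) * emeasure lborel (annulus m))"
    by (simp add: nn_integral_cmult_indicator)
  also have "\<dots> \<le> (\<Sum>m. ennreal (2 * K powr p * T p m))"
  proof (rule suminf_le)
    fix m
    have "c m * measure lborel (annulus m) \<le> c m * (pi * (1/2) ^ m)"
      by (intro mult_left_mono measure_annulus_bounds c0)
    also have "\<dots> = 2 * K powr p * T p m"
      by (simp add: c_def power_divide)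
    finally show "ennreal (c m) * emeasure lborel (annulus m) \<le> ennreal (2 * K powr p * T p m)"
      unfolding emeasure_annulus using c0 by (simp flip: ennreal_mult add: ennreal_leI)
  qed auto
  also have "\<dots> < \<infinity>"
    using summable_T T_nonneg by (subst suminf_ennreal2) (auto intro!: summable_mult)
  finally show ?thesis
    using analytic_disc_f by (simp add: Dirichlet_type_def)
qed

end

end

subsection \<open>Integral estimates\<close>

text \<open>Comparison with twice the maximum treats q < 1 and q >= 1 alike.\<close>

lemma powr_add_le:
  fixes x y q :: real
  assumes "0 \<le> x" "0 \<le> y" "0 < q"
  shows "(x + y) powr q \<le> 2 powr q * (x powr q + y powr q)"
proof -
  have "(x + y) powr q \<le> (2 * max x y) powr q"
    using assms by (intro powr_mono2) auto
  also have "\<dots> = 2 powr q * max x y powr q"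
    using assms by (simp add: powr_mult)
  also have "max x y powr q \<le> x powr q + y powr q"
    by (simp add: max_def)
  finally show ?thesis by simp
qed

text \<open>\<open>m\<close> is the index of the first non-zero Taylor coefficient at 0, which
  exists by the identity theorem, and \<open>h\<close> is the sum of the shifted series.\<close>

lemma holomorphic_factor_zero_disc:
  assumes g: "g holomorphic_on ball 0 1" and nz: "w \<in> ball 0 1" "g w \<noteq> 0"
  obtains m h where "h holomorphic_on ball 0 1" "h 0 \<noteq> 0" "\<And>z. z \<in> ball 0 1 \<Longrightarrow> g z = z ^ m * h z"
proof -
  define c where "c n = (deriv ^^ n) g 0 / fact n" for n
  define m where "m = (LEAST n. c n \<noteq> 0)"
  define h where "h z = (if z = 0 then c m else g z / z ^ m)" for z
  have sums: "(\<lambda>n. c n * z ^ n) sums g z" if "z \<in> ball 0 1" for z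
    using holomorphic_power_series[OF g that] by (simp add: c_def)
  have "\<exists>n. c n \<noteq> 0"
    using holomorphic_fun_eq_0_on_ball[OF g nz(1)] nz(2) by (auto simp: c_def)
  then have cm: "c m \<noteq> 0" unfolding m_def by (rule LeastI_ex)
  have c0: "c n = 0" if "n < m" for n
    using that not_less_Least[of n "\<lambda>n. c n \<noteq> 0"] by (auto simp: m_def)
  have hsums: "(\<lambda>n. c (n + m) * z ^ n) sums h z" if z: "z \<in> ball 0 1" for z
  proof (cases "z = 0")
    case True
    then show ?thesis using powser_sums_zero[of "\<lambda>n. c (n + m)"] by (simp add: h_def)
  next
    case False
    have "(\<lambda>n. c (n + m) * z ^ (n + m)) sums g z"
      using sums[OF z] c0 sums_iff_shift[of "\<lambda>n. c n * z ^ n" m "g z"] by simp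
    then have "(\<lambda>n. c (n + m) * z ^ (n + m) / z ^ m) sums (g z / z ^ m)"
      by (rule sums_divide)
    then show ?thesis using False by (simp add: h_def power_add)
  qed
  show ?thesis
  proof (rule that)
    show "h holomorphic_on ball 0 1"
      using power_series_holomorphic[of 0 1 "\<lambda>n. c (n + m)" h] hsums by simp
    show "h 0 \<noteq> 0" using cm by (simp add: h_def)
    fix z :: complex assume "z \<in> ball 0 1"
    show "g z = z ^ m * h z"
    proof (cases "z = 0")
      case True
      have "g 0 = c 0" by (simp add: c_def)
      then show ?thesis using True c0[of 0] by (cases "m = 0") (auto simp: h_def)
    qed (simp add: h_def)
  qed
qed

lemma set_integrable_annulus:
  fixes F :: "complex \<Rightarrow> 'b::{banach, second_countable_topology}"
  assumes "continuous_on (ball 0 1) F"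
  shows "set_integrable lborel (annulus m) F"
proof -
  have sub: "cball 0 (1 - (1/2)^Suc m) \<subseteq> ball (0::complex) 1"
    by (simp add: cball_subset_ball_iff)
  have "set_integrable lborel (cball 0 (1 - (1/2)^Suc m)) F"
    unfolding set_integrable_def
    using assms sub by (intro borel_integrable_compact continuous_on_subset[OF assms]) auto
  then show ?thesis
    by (rule set_integrable_subset) (use annulus_subset in auto)
qed

text \<open>Only \<open>2 Re (cnj F(0) F(z)) - |F(0)|\<^sup>2 \<le> |F(z)|\<^sup>2\<close> is integrated, so the mean value
  property of \<open>F\<close> suffices.\<close>
lemma annulus_submean_value:
  assumes F: "F holomorphic_on ball 0 1" and u: "set_integrable lborel (annulus m) u"
    and le: "\<And>z. z \<in> annulus m \<Longrightarrow> (cmod (F z))\<^sup>2 \<le> u z"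
  shows "(cmod (F 0))\<^sup>2 * measure lborel (annulus m) \<le> (LINT z:annulus m|lborel. u z)"
proof -
  define T where "T w = 2 * Re (cnj (F 0) * w)" for w
  have bl: "bounded_linear T"
    unfolding T_def
    by (intro bounded_linear_const_mult bounded_linear_compose[OF bounded_linear_Re] bounded_linear_mult_right)
  have intF: "integrable lborel (\<lambda>z. indicator (annulus m) z *\<^sub>R F z)"
    using set_integrable_annulus[OF holomorphic_on_imp_continuous_on[OF F]] by (simp add: set_integrable_def)
  have Tint: "set_integrable lborel (annulus m) (\<lambda>z. T (F z))"
    "(LINT z:annulus m|lborel. T (F z)) = T (LINT z:annulus m|lborel. F z)"
    using integrable_bounded_linear[OF bl intF] integral_bounded_linear[OF bl intF]
    by (simp_all add: set_integrable_def set_lebesgue_integral_def linear_simps[OF bl])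
  have cint: "set_integrable lborel (annulus m) (\<lambda>z. (cmod (F 0))\<^sup>2)"
    by (intro set_integrable_annulus continuous_intros)
  have "(LINT z:annulus m|lborel. F z) = measure lborel (annulus m) *\<^sub>R F 0"
    by (rule set_integral_holomorphic_mean_value[OF annulus_borel _ _ annulus_subset(1) F]) (simp_all add: annulus_rotate)
  then have "T (LINT z:annulus m|lborel. F z) = 2 * (cmod (F 0))\<^sup>2 * measure lborel (annulus m)"
    by (simp add: T_def linear_simps[OF bl] cmod_power2) (simp add: power2_eq_square algebra_simps)
  then have "(cmod (F 0))\<^sup>2 * measure lborel (annulus m)
      = (LINT z:annulus m|lborel. T (F z)) - (LINT z:annulus m|lborel. (cmod (F 0))\<^sup>2)"
    by (simp add: Tint emeasure_annulus set_integral_const)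
  also have "\<dots> = (LINT z:annulus m|lborel. T (F z) - (cmod (F 0))\<^sup>2)"
    using Tint cint by simp
  also have "\<dots> \<le> (LINT z:annulus m|lborel. u z)"
  proof (rule set_integral_mono)
    fix z assume z: "z \<in> annulus m"
    have "T (F z) = (cmod (F z))\<^sup>2 + (cmod (F 0))\<^sup>2 - (cmod (F z - F 0))\<^sup>2"
      unfolding T_def cmod_power2 by (simp add: power2_eq_square algebra_simps)
    then show "T (F z) - (cmod (F 0))\<^sup>2 \<le> u z"
      using le[OF z] zero_le_power2[of "cmod (F z - F 0)"] by linarith
  qed (use Tint cint u in auto)
  finally show ?thesis .
qed

lemma Dirichlet_type_integrable:
  assumes F: "F \<in> Dirichlet_type q" and q: "q > 0"
  shows "set_integrable lborel (ball 0 1) (\<lambda>z. (1 - cmod z) powr (q - 1) * cmod (deriv F z) powr q)"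
    (is "set_integrable _ _ ?w")
proof -
  have hol: "deriv F holomorphic_on ball 0 1"
    using F by (auto simp: Dirichlet_type_def analytic_disc_def intro: holomorphic_deriv)
  have [measurable]: "(\<lambda>z. indicator (ball 0 1) z *\<^sub>R deriv F z) \<in> borel_measurable borel"
    by (intro borel_measurable_continuous_on_indicator holomorphic_on_imp_continuous_on hol) auto
  \<comment> \<open>As \<open>0 powr q = 0\<close>, the indicator may be moved inside the norm,
    where measurability follows from holomorphy.\<close>
  have eq: "indicator (ball 0 1) z *\<^sub>R ?w z
      = (1 - cmod z) powr (q - 1) * cmod (indicator (ball 0 1) z *\<^sub>R deriv F z) powr q" for z
    by (auto simp: indicator_def)
  have meas: "(\<lambda>z. indicator (ball 0 1) z *\<^sub>R ?w z) \<in> borel_measurable lborel"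
    unfolding eq by measurable
  have "(\<integral>\<^sup>+ z. ennreal (norm (indicator (ball 0 1) z *\<^sub>R ?w z)) \<partial>lborel)
      = (\<integral>\<^sup>+ z. ennreal pi * (ennreal ((1 / pi) * (1 - cmod z) powr (q - 1) * cmod (deriv F z) powr q)
          * indicator (ball 0 1) z) \<partial>lborel)"
    by (intro nn_integral_cong) (auto simp: indicator_def simp flip: ennreal_mult)
  also have "\<dots> = ennreal pi * (\<integral>\<^sup>+ z \<in> ball 0 1. ennreal ((1 / pi) * (1 - cmod z) powr (q - 1) * cmod (deriv F z) powr q) \<partial>lborel)"
  proof (rule nn_integral_cmult)
    have "(\<lambda>z. ennreal ((1 / pi) * (indicator (ball 0 1) z *\<^sub>R ?w z))) \<in> borel_measurable lborel"
      using meas by measurable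
    then show "(\<lambda>z. ennreal ((1 / pi) * (1 - cmod z) powr (q - 1) * cmod (deriv F z) powr q)
          * indicator (ball 0 1) z) \<in> borel_measurable lborel"
      by (rule measurable_cong[THEN iffD1, rotated]) (auto simp: indicator_def)
  qed
  also have "\<dots> < \<infinity>"
    using F by (auto simp: Dirichlet_type_def ennreal_mult_less_top)
  finally show ?thesis
    unfolding set_integrable_def using meas by (intro integrableI_bounded)
qed

text \<open>By the product rule f' g = (f g)' - f g', and boundedness of \<open>f\<close> reduces
  the last term to g'.\<close>

lemma multiplier_integrable:
  assumes q: "q > 0" and f: "analytic_disc f" "\<And>z. cmod (f z) \<le> B"
    and g: "g \<in> Dirichlet_type q" and fg: "(\<lambda>z. f z * g z) \<in> Dirichlet_type q"
  shows "set_integrable lborel (ball 0 1) (\<lambda>z. (1 - cmod z) powr (q - 1) * (cmod (deriv f z) * cmod (g z)) powr q)"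
proof -
  let ?fg = "\<lambda>z. f z * g z"
  let ?w = "\<lambda>F z. (1 - cmod z) powr (q - 1) * cmod (deriv F z) powr q"
  have B: "B \<ge> 0" using f(2)[of 0] norm_ge_zero order_trans by blast
  have fh: "f holomorphic_on ball 0 1" and gh: "g holomorphic_on ball 0 1"
    using f g by (auto simp: analytic_disc_def Dirichlet_type_def)
  have f'h: "deriv f holomorphic_on ball 0 1"
    using fh by (intro holomorphic_deriv) auto
  have [measurable]: "(\<lambda>z. indicator (ball 0 1) z *\<^sub>R (deriv f z * g z)) \<in> borel_measurable borel"
    by (intro borel_measurable_continuous_on_indicator holomorphic_on_imp_continuous_on holomorphic_intros f'h gh) auto
  have eq: "indicator (ball 0 1) z *\<^sub>R ((1 - cmod z) powr (q - 1) * (cmod (deriv f z) * cmod (g z)) powr q)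
      = (1 - cmod z) powr (q - 1) * cmod (indicator (ball 0 1) z *\<^sub>R (deriv f z * g z)) powr q" for z
    by (auto simp: indicator_def norm_mult)
  have "set_integrable lborel (ball 0 1) (\<lambda>z. 2 powr q * (?w ?fg z + B powr q * ?w g z))"
    by (intro set_integrable_mult_right set_integral_add Dirichlet_type_integrable fg g q)
  then show ?thesis
  proof (rule set_integrable_bound)
    show "set_borel_measurable lborel (ball 0 1)
        (\<lambda>z. (1 - cmod z) powr (q - 1) * (cmod (deriv f z) * cmod (g z)) powr q)"
      unfolding set_borel_measurable_def eq by measurable
    show "AE z in lborel. z \<in> ball 0 1 \<longrightarrow>
        norm ((1 - cmod z) powr (q - 1) * (cmod (deriv f z) * cmod (g z)) powr q)
        \<le> norm (2 powr q * (?w ?fg z + B powr q * ?w g z))"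
    proof (intro AE_I2 impI)
      fix z :: complex assume z: "z \<in> ball 0 1"
      have "deriv ?fg z = f z * deriv g z + deriv f z * g z"
        using z fh gh by (intro complex_derivative_mult_at) (auto simp: analytic_at intro!: exI[of _ "ball 0 1"])
      then have "cmod (deriv f z) * cmod (g z) = cmod (deriv ?fg z - f z * deriv g z)"
        by (simp add: norm_mult)
      also have "\<dots> \<le> cmod (deriv ?fg z) + cmod (f z) * cmod (deriv g z)"
        by (metis norm_triangle_ineq4 norm_mult)
      also have "\<dots> \<le> cmod (deriv ?fg z) + B * cmod (deriv g z)"
        by (intro add_left_mono mult_right_mono f) auto
      finally have "(cmod (deriv f z) * cmod (g z)) powr q \<le> (cmod (deriv ?fg z) + B * cmod (deriv g z)) powr q"
        using q by (intro powr_mono2) auto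
      also have "\<dots> \<le> 2 powr q * (cmod (deriv ?fg z) powr q + (B * cmod (deriv g z)) powr q)"
        using q B by (intro powr_add_le) auto
      also have "\<dots> = 2 powr q * (cmod (deriv ?fg z) powr q + B powr q * cmod (deriv g z) powr q)"
        using B by (simp add: powr_mult)
      finally have "(1 - cmod z) powr (q - 1) * (cmod (deriv f z) * cmod (g z)) powr q
        \<le> (1 - cmod z) powr (q - 1) * (2 powr q * (cmod (deriv ?fg z) powr q + B powr q * cmod (deriv g z) powr q))"
        by (intro mult_left_mono) auto
      also have "\<dots> = 2 powr q * (?w ?fg z + B powr q * ?w g z)"
        by (simp add: algebra_simps)
      finally show "norm ((1 - cmod z) powr (q - 1) * (cmod (deriv f z) * cmod (g z)) powr q)
        \<le> norm (2 powr q * (?w ?fg z + B powr q * ?w g z))"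
        by simp
    qed
  qed
qed

text \<open>The selected annuli are disjoint subsets of the disc, so the integral over the disc
  bounds all partial sums.\<close>

lemma summable_annulus_integrals:
  fixes w :: "complex \<Rightarrow> real"
  assumes w: "set_integrable lborel (ball 0 1) w" "\<And>z. w z \<ge> 0" and N: "inj N"
  shows "summable (\<lambda>k. LINT z:annulus (N k)|lborel. w z)"
proof (rule summableI_nonneg_bounded)
  have int: "set_integrable lborel (annulus m) w" for m
    by (rule set_integrable_subset[OF w(1)]) (use annulus_subset in auto)
  show "0 \<le> (LINT z:annulus (N k)|lborel. w z)" for k
    unfolding set_lebesgue_integral_def using w by (intro integral_nonneg_AE AE_I2) auto
  fix n
  have disj: "disjoint_family_on (\<lambda>k. annulus (N k)) {..<n}"
    using disjoint_family_annulus N unfolding disjoint_family_on_def inj_def by (metis UNIV_I)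
  have "(\<Sum>k<n. LINT z:annulus (N k)|lborel. w z) = (LINT z:(\<Union>k<n. annulus (N k))|lborel. w z)"
    using int disj by (intro set_integral_finite_Union[symmetric]) auto
  also have "\<dots> \<le> (LINT z:ball 0 1|lborel. w z)"
    unfolding set_lebesgue_integral_def
  proof (rule integral_mono)
    show "integrable lborel (\<lambda>z. indicator (\<Union>k<n. annulus (N k)) z *\<^sub>R w z)"
      using set_integrable_subset[OF w(1), of "\<Union>k<n. annulus (N k)"] annulus_subset
      by (auto simp: set_integrable_def)
    show "integrable lborel (\<lambda>z. indicator (ball 0 1) z *\<^sub>R w z)"
      using w(1) by (simp add: set_integrable_def)
    show "indicator (\<Union>k<n. annulus (N k)) z *\<^sub>R w z \<le> indicator (ball 0 1) z *\<^sub>R w z" for z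
      using w(2)[of z] by (auto simp: indicator_def dest!: subsetD[OF annulus_subset(2)])
  qed
  finally show "(\<Sum>k<n. LINT z:annulus (N k)|lborel. w z) \<le> (LINT z:ball 0 1|lborel. w z)" .
qed

subsection \<open>Lower bounds and the conclusion\<close>

context golay
begin

text \<open>With e = expo k, 1 - |z| lies between 1/(4e) and 1/(2e) here, and block \<open>k\<close>
  contributes the main term of f'. Earlier blocks and the term with the derivative of
  \<open>Qs k\<close> cost at most M e / 2^k each, later blocks 128 times that. After division by e,
  passing from \<open>Qs k\<close> to \<open>Q k\<close> costs one more M / 2^k. The factor 1/2
  bounds |z|^(e-1) from below.\<close>

lemma main_block_lower_bound:
  assumes z: "z \<in> annulus (Suc ((Suc k)\<^sup>2))"
  shows "a k / 2 * cmod (Q k z) \<le> cmod (deriv f z) / expo k + 131 * M * (1/2) ^ k"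
proof -
  define e where "e = real (expo k)"
  define t where "t = 1 - cmod z"
  define m where "m = Suc ((Suc k)\<^sup>2)"
  have M: "M \<ge> 1" by (rule M_ge_1)
  have e: "e \<ge> 2" using expo_ge_2[of k] by (simp add: e_def)
  have em: "(1/2) ^ m = 1 / (2 * e)"
    by (simp add: e_def m_def expo_def power_divide)
  have t: "t \<le> 1 / (2 * e)" "1 / (4 * e) < t" "0 < t" "t < 1" "cmod z \<le> 1"
  proof -
    show "t \<le> 1 / (2 * e)" "0 < t" "cmod z \<le> 1"
      using annulusD[OF z] em by (auto simp: t_def m_def)
    show "1 / (4 * e) < t"
      using annulusD(2)[OF z] em by (simp add: t_def m_def)
    have "1 / (2 * e) < 1" using e by simp
    with \<open>t \<le> 1 / (2 * e)\<close> show "t < 1" by simp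
  qed
  have z0: "z \<noteq> 0" using t by (auto simp: t_def)
  have D: "D k = M * e * (1/2) ^ k"
    by (simp add: D_def e_def power_divide)
  have tail: "cmod (deriv (P n) z - deriv (P (Suc k)) z) \<le> 128 * M * e * (1/2) ^ k" if n: "Suc k \<le> n" for n
  proof -
    define \<Delta> where "\<Delta> = deriv (P n) z - deriv (P (Suc k)) z"
    \<comment> \<open>The squares are so far apart that each later block \<open>j\<close> is damped
      by at least 2^j on this annulus.\<close>
    have gap: "j \<le> gap m j" if "Suc k \<le> j" for j
    proof -
      obtain i where i: "j = Suc k + i" using le_Suc_ex[OF \<open>Suc k \<le> j\<close>] by blast
      have "m + j \<le> (Suc j)\<^sup>2"
        unfolding m_def i by (simp add: power2_eq_square algebra_simps)
      then show ?thesis by (simp add: gap_def)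
    qed
    have "t * cmod (\<Delta>) \<le> 32 * M * (\<Sum>j=Suc k..<n. a j * (1/2) ^ gap m j)"
      using deriv_P_diff_bound[OF z n] unfolding t_def m_def \<Delta>_def .
    also have "(\<Sum>j=Suc k..<n. a j * (1/2) ^ gap m j) \<le> (\<Sum>j=Suc k..<n. 1 * (1/2) ^ j)"
      using gap a_nonneg a_le_1 by (intro sum_mono mult_mono power_decreasing) auto
    also have "\<dots> = (1/2) ^ k * (\<Sum>j=Suc k..<n. (1/2) ^ (j - k))"
      unfolding sum_distrib_left by (intro sum.cong) (auto simp flip: power_add)
    also have "(\<Sum>j=Suc k..<n. (1/2::real) ^ (j - k)) = (\<Sum>j=Suc k..<n. (1/2) * (1/2) ^ (j - Suc k))"
      by (intro sum.cong) (auto simp flip: power_Suc simp: Suc_diff_Suc)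
    also have "\<dots> = (1/2) * (\<Sum>j=Suc k..<n. (1/2) ^ (j - Suc k))"
      by (simp only: sum_distrib_left)
    also have "(\<Sum>j=Suc k..<n. (1/2::real) ^ (j - Suc k)) \<le> 1 / (1 - 1/2)"
      by (intro geometric_sum_le) (auto simp: inj_on_def)
    finally have "t * cmod (\<Delta>) \<le> 32 * M * (1/2) ^ k"
      using M by (simp add: mult_left_mono)
    moreover have "1 / (4 * e) * cmod (\<Delta>) \<le> t * cmod (\<Delta>)"
      using t by (intro mult_right_mono) auto
    ultimately have "1 / (4 * e) * cmod (\<Delta>) \<le> 32 * M * (1/2) ^ k"
      by linarith
    then have "cmod \<Delta> \<le> 128 * M * e * (1/2) ^ k" using e by (simp add: field_simps)
    then show ?thesis unfolding \<Delta>_def .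
  qed
  have tri: "cmod (x - y - u - v) \<le> cmod x + cmod y + cmod u + cmod v" for x y u v :: complex
    using norm_triangle_ineq4[of "x - y - u" v] norm_triangle_ineq4[of "x - y" u] norm_triangle_ineq4[of x y]
    by linarith
  have a1: "cmod (a k * w) \<le> cmod w" for w :: complex
    using a_nonneg[of k] a_le_1[of k] by (simp add: norm_mult mult_left_le_one_le)
  have "cmod (a k * (z ^ expo k * deriv (Qs k) z)) \<le> cmod (z ^ expo k * deriv (Qs k) z)"
    by (rule a1)
  also have "\<dots> \<le> 1 * D k"
    unfolding norm_mult norm_power using t deriv_bounds by (intro mult_mono power_le_one) auto
  finally have dQs: "cmod (a k * (z ^ expo k * deriv (Qs k) z)) \<le> D k" by simp
  have "cmod (deriv f z - deriv (P (Suc k)) z) \<le> 128 * M * e * (1/2) ^ k"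
  proof (rule Lim_norm_ubound)
    show "(\<lambda>n. deriv (P n) z - deriv (P (Suc k)) z) \<longlonglongrightarrow> deriv f z - deriv (P (Suc k)) z"
      using t by (intro tendsto_intros deriv_P_tendsto) (auto simp: t_def)
    show "\<forall>\<^sub>F n in sequentially. cmod (deriv (P n) z - deriv (P (Suc k)) z) \<le> 128 * M * e * (1/2) ^ k"
      using eventually_ge_at_top[of "Suc k"] by eventually_elim (rule tail)
  qed simp
  moreover note dQs
  moreover have "cmod (deriv (P k) z) \<le> D k"
    using t by (intro deriv_bounds)
  moreover have "a k * (expo k * z ^ (expo k - 1) * Qs k z)
     = deriv f z - (deriv f z - deriv (P (Suc k)) z) - deriv (P k) z - a k * (z ^ expo k * deriv (Qs k) z)"
    unfolding deriv_Suc by (simp add: algebra_simps)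
  then have "cmod (a k * (expo k * z ^ (expo k - 1) * Qs k z)) \<le> cmod (deriv f z)
      + cmod (deriv f z - deriv (P (Suc k)) z) + cmod (deriv (P k) z) + cmod (a k * (z ^ expo k * deriv (Qs k) z))"
    using tri by metis
  ultimately have "cmod (a k * (expo k * z ^ (expo k - 1) * Qs k z)) \<le> cmod (deriv f z) + 130 * M * e * (1/2) ^ k"
    unfolding D by linarith
  then have 1: "a k * e * cmod z ^ (expo k - 1) * cmod (Qs k z) \<le> cmod (deriv f z) + 130 * M * e * (1/2) ^ k"
    by (simp add: norm_mult norm_power a_nonneg e_def mult_ac)
  have QQs: "cmod (Q k z) \<le> cmod (Qs k z) + M * (1/2) ^ k"
  proof -
    have "2 * D k * t \<le> 2 * D k * (1 / (2 * e))"
      using t D_nonneg[of k] by (intro mult_left_mono) auto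
    also have "\<dots> = M * (1/2) ^ k"
      using e by (simp add: D)
    finally show ?thesis
      using Qs_near_Q[of z k] t z0 by (simp add: t_def)
  qed
  \<comment> \<open>Bernoulli's inequality; the successor in the index of the annulus is what yields
    e t <= 1/2.\<close>
  have "1 - e * t \<le> cmod z ^ expo k"
    using Bernoulli_inequality[of "-t" "expo k"] t by (simp add: t_def e_def right_diff_distrib)
  moreover have "e * t \<le> 1 / 2"
    using mult_left_mono[OF t(1), of e] e by simp
  ultimately have "1 / 2 \<le> cmod z ^ expo k" by linarith
  also have "\<dots> \<le> cmod z ^ (expo k - 1)"
    using t by (intro power_decreasing) auto
  finally have r: "1 / 2 \<le> cmod z ^ (expo k - 1)" .
  have "a k / 2 * cmod (Q k z) = a k * (1 / 2) * cmod (Q k z)" by simp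
  also have "\<dots> \<le> a k * cmod z ^ (expo k - 1) * cmod (Q k z)"
    using r a_nonneg by (intro mult_right_mono mult_left_mono) auto
  also have "\<dots> \<le> a k * cmod z ^ (expo k - 1) * (cmod (Qs k z) + M * (1/2) ^ k)"
    using QQs a_nonneg by (intro mult_left_mono) auto
  also have "\<dots> = a k * cmod z ^ (expo k - 1) * cmod (Qs k z) + a k * cmod z ^ (expo k - 1) * (M * (1/2) ^ k)"
    by (simp add: algebra_simps)
  also have "a k * cmod z ^ (expo k - 1) * (M * (1/2) ^ k) \<le> 1 * 1 * (M * (1/2) ^ k)"
    using a_nonneg a_le_1 t M by (intro mult_mono power_le_one) auto
  also have "a k * cmod z ^ (expo k - 1) * cmod (Qs k z) \<le> (cmod (deriv f z) + 130 * M * e * (1/2) ^ k) / e"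
    using 1 e by (simp add: field_simps)
  finally show ?thesis
    using e by (simp add: e_def add_divide_distrib)
qed

text \<open>A constant multiple of a_k^q is bounded by a combination of the summable
  \<open>W k\<close> and \<open>Y k\<close>. Since Q_k h is bounded and q < 2, |Q_k h|^q dominates a
  multiple of |Q_k h|^2, to which the mean value estimate applies.\<close>

lemma multiplier_imp_summable:
  assumes q: "0 < q" "q < 2" and g: "g \<in> Dirichlet_type q" "g \<in> H_infty" "g \<noteq> (\<lambda>z. 0)"
    and fg: "(\<lambda>z. f z * g z) \<in> Dirichlet_type q"
  shows "summable (\<lambda>k. a k powr q)"
proof -
  define N where "N k = Suc ((Suc k)\<^sup>2)" for k
  define w where "w z = (1 - cmod z) powr (q - 1) * (cmod (deriv f z) * cmod (g z)) powr q" for z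
  define W where "W k = (LINT z:annulus (N k)|lborel. w z)" for k
  have w_int: "set_integrable lborel (ball 0 1) w"
    unfolding w_def using norm_f_le by (intro multiplier_integrable[OF q(1) analytic_disc_f _ g(1) fg])
  have sumW: "summable W"
    unfolding W_def
    by (rule summable_annulus_integrals[OF w_int]) (auto simp: w_def N_def inj_def power2_eq_iff_nonneg)
  obtain z1 where z1: "g z1 \<noteq> 0" using g(3) by auto
  have gan: "g holomorphic_on ball 0 1" "z1 \<in> ball 0 1"
    using g(1) z1 by (auto simp: Dirichlet_type_def analytic_disc_def)
  obtain d h where h: "h holomorphic_on ball 0 1" "h 0 \<noteq> 0" "\<And>z. z \<in> ball 0 1 \<Longrightarrow> g z = z ^ d * h z"
    using holomorphic_factor_zero_disc[OF gan z1] by blast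
  obtain G where G: "G > 0" "\<And>z. z \<in> ball 0 1 \<Longrightarrow> cmod (g z) \<le> G"
    using g(2) unfolding H_infty_def bounded_pos by auto
  have M: "M \<ge> 1" by (rule M_ge_1)
  \<comment> \<open>On the annuli used, |z| >= 1/2, so |h| <= 2^d |g| <= 2^d G; thus
    \<open>Kb\<close> bounds |Q_k h| there.\<close>
  define Kb where "Kb = M * (2 ^ d * G)"
  \<comment> \<open>The factors come from raising the exponent from q to 2, from 2^d for
    \<open>h\<close> together with 2 for the halved coefficient, and from
    \<open>powr_add_le\<close>.\<close>
  define B where "B = Kb powr (2 - q) * (2 ^ Suc d) powr q * 2 powr q"
  \<comment> \<open>The error of \<open>main_block_lower_bound\<close> times the bound for
    \<open>g\<close>, to the power q; geometric in \<open>k\<close>.\<close>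
  define Y where "Y k = (131 * M * (1/2) ^ k * G) powr q" for k
  have sumY: "summable Y"
  proof -
    have "Y = (\<lambda>k. (131 * M * G) powr q * ((1/2) powr q) ^ k)"
    proof
      fix k
      have "Y k = ((131 * M * G) * (1/2) ^ k) powr q"
        by (simp add: Y_def mult_ac)
      also have "\<dots> = (131 * M * G) powr q * ((1/2) ^ k) powr q"
        using M G by (intro powr_mult)
      also have "((1/2) ^ k) powr q = ((1/2::real) powr q) ^ k"
        by (simp add: powr_powr mult.commute flip: powr_realpow)
      finally show "Y k = (131 * M * G) powr q * ((1/2) powr q) ^ k" .
    qed
    moreover have "(1/2::real) powr q < 1"
      using powr_less_mono2[of q "1/2" 1] q by simp
    ultimately show ?thesis
      by (simp add: summable_mult summable_geometric)
  qed
  have B: "B \<ge> 0" by (simp add: B_def)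
  have point: "a k powr q * (cmod (Q k z * h z))\<^sup>2 \<le> B * (4 / expo k * w z + Y k)"
    if z: "z \<in> annulus (N k)" for k z
  proof -
    define e where "e = real (expo k)"
    define t where "t = 1 - cmod z"
    have e: "e \<ge> 2" using expo_ge_2[of k] by (simp add: e_def)
    have em: "(1/2) ^ N k = 1 / (2 * e)"
      by (simp add: e_def N_def expo_def power_divide)
    have t: "t \<le> 1 / (2 * e)" "1 / (4 * e) < t" "0 < t"
      using annulusD[OF z] em by (auto simp: t_def)
    have te: "t * e \<le> 1 / 2" "1 / 4 < t * e"
      using t e by (simp_all add: field_simps)
    have zb: "z \<in> ball 0 1" using annulus_subset z by blast
    have "1 / (2 * e) \<le> 1 / 2" using e by simp
    then have z2: "1 / 2 \<le> cmod z" using t by (simp add: t_def)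
    have "(1/2) ^ d * cmod (h z) \<le> cmod z ^ d * cmod (h z)"
      using z2 by (intro mult_right_mono power_mono) auto
    then have hg: "cmod (h z) \<le> 2 ^ d * cmod (g z)"
      using h(3)[OF zb] by (simp add: norm_mult norm_power power_divide field_simps)
    have Fb: "cmod (Q k z * h z) \<le> Kb"
      unfolding Kb_def norm_mult
      using disc_bounds(2)[of z k] zb G(2)[OF zb] M hg
      by (intro mult_mono) (auto intro: order_trans mult_left_mono)
    define X where "X = cmod (deriv f z) * cmod (g z)"
    have "a k * cmod (Q k z * h z) \<le> a k * (cmod (Q k z) * (2 ^ d * cmod (g z)))"
      unfolding norm_mult by (intro mult_left_mono hg a_nonneg) auto
    also have "\<dots> = 2 ^ Suc d * ((a k / 2 * cmod (Q k z)) * cmod (g z))"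
      by simp
    also have "\<dots> \<le> 2 ^ Suc d * ((cmod (deriv f z) / e + 131 * M * (1/2) ^ k) * cmod (g z))"
      unfolding e_def by (intro mult_left_mono mult_right_mono main_block_lower_bound z[unfolded N_def]) auto
    also have "\<dots> \<le> 2 ^ Suc d * (X / e + 131 * M * (1/2) ^ k * G)"
      using G(2)[OF zb] M by (simp add: X_def algebra_simps mult_left_mono)
    finally have "(a k * cmod (Q k z * h z)) powr q \<le> (2 ^ Suc d * (X / e + 131 * M * (1/2) ^ k * G)) powr q"
      using q a_nonneg by (intro powr_mono2) auto
    also have "\<dots> = (2 ^ Suc d) powr q * (X / e + 131 * M * (1/2) ^ k * G) powr q"
      using e M G by (intro powr_mult)
    also have "\<dots> \<le> (2 ^ Suc d) powr q * (2 powr q * ((X / e) powr q + Y k))"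
      unfolding Y_def using q e M G by (intro mult_left_mono powr_add_le) (auto simp: X_def)
    also have "(X / e) powr q \<le> 4 / e * w z"
    proof -
      \<comment> \<open>(X/e)^q equals w z / e times this power. As t e lies in (1/4, 1/2] and q <
        2, the power is at most 1 or at most 4^(q-1).\<close>
      have "(t * e) powr (1 - q) \<le> 4"
      proof (cases "q \<le> 1")
        case True
        then have "(t * e) powr (1 - q) \<le> 1"
          using te by (intro powr_le1) auto
        then show ?thesis by simp
      next
        case False
        have "(t * e) powr (1 - q) \<le> (1 / 4) powr (1 - q)"
          using te False by (intro powr_mono2') auto
        also have "\<dots> = 4 powr (q - 1)"
          by (simp add: powr_divide powr_minus_divide[of 4 "1 - q", simplified, symmetric])
        also have "\<dots> \<le> 4 powr 1"
          using q by (intro powr_mono) auto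
        finally show ?thesis by simp
      qed
      then have "(t * e) powr (1 - q) / e * w z \<le> 4 / e * w z"
        using e by (intro mult_right_mono divide_right_mono) (auto simp: w_def)
      moreover have "(X / e) powr q = (t * e) powr (1 - q) / e * w z"
      proof -
        have "(X / e) powr q = X powr q / e powr q"
          using e by (simp add: X_def powr_divide)
        moreover have "(t * e) powr (1 - q) / e = t powr (1 - q) / e powr q"
          using e t by (simp add: powr_mult powr_diff)
        moreover have "t powr (1 - q) * t powr (q - 1) = 1"
          using t by (simp flip: powr_add)
        ultimately show ?thesis
          by (simp add: w_def t_def X_def)
      qed
      ultimately show ?thesis by simp
    qed
    finally have ap: "a k powr q * cmod (Q k z * h z) powr q
        \<le> (2 ^ Suc d) powr q * (2 powr q * (4 / e * w z + Y k))"
      using a_nonneg by (simp add: powr_mult)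
    have "(cmod (Q k z * h z))\<^sup>2 \<le> Kb powr (2 - q) * cmod (Q k z * h z) powr q"
    proof (cases "cmod (Q k z * h z) = 0")
      case False
      then have "(cmod (Q k z * h z))\<^sup>2 = cmod (Q k z * h z) powr (2 - q) * cmod (Q k z * h z) powr q"
        by (simp flip: powr_add powr_numeral)
      also have "\<dots> \<le> Kb powr (2 - q) * cmod (Q k z * h z) powr q"
        using q Fb by (intro mult_right_mono powr_mono2) auto
      finally show ?thesis .
    qed auto
    then have "a k powr q * (cmod (Q k z * h z))\<^sup>2 \<le> a k powr q * (Kb powr (2 - q) * cmod (Q k z * h z) powr q)"
      by (intro mult_left_mono) auto
    also have "\<dots> = Kb powr (2 - q) * (a k powr q * cmod (Q k z * h z) powr q)"
      by simp
    also have "\<dots> \<le> Kb powr (2 - q) * ((2 ^ Suc d) powr q * (2 powr q * (4 / e * w z + Y k)))"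
      by (intro mult_left_mono ap) auto
    finally show ?thesis by (simp add: B_def e_def mult.assoc)
  qed
  have int: "a k powr q * (cmod (h 0))\<^sup>2 * (pi / 8) \<le> B * (4 * W k + Y k * (pi / 2))" for k
  proof -
    define A where "A = measure lborel (annulus (N k))"
    define e where "e = real (expo k)"
    have e: "e \<ge> 2" using expo_ge_2[of k] by (simp add: e_def)
    have em: "(1/2) ^ N k = 1 / (2 * e)"
      by (simp add: e_def N_def expo_def power_divide)
    \<comment> \<open>The area is comparable to 1/e, so multiplication by e makes the integrated
      estimate independent of the scale.\<close>
    have A: "pi / 8 \<le> e * A" "e * A \<le> pi / 2"
      using measure_annulus_bounds[of "N k"] e unfolding em A_def by (simp_all add: field_simps)
    \<comment> \<open>The coefficient enters as a_k^(q/2), so that |F|^2 is the left side of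
      \<open>point\<close> and F(0) = a_k^(q/2) h(0).\<close>
    define F where "F z = of_real (a k powr (q / 2)) * (Q k z * h z)" for z
    define u where "u z = B * (4 / e * w z + Y k)" for z
    have wk: "set_integrable lborel (annulus (N k)) w"
      by (rule set_integrable_subset[OF w_int]) (use annulus_subset in auto)
    have ck: "set_integrable lborel (annulus (N k)) (\<lambda>z. Y k)"
      by (intro set_integrable_annulus continuous_intros)
    have sq: "(cmod (F z))\<^sup>2 = a k powr q * (cmod (Q k z * h z))\<^sup>2" for z
      by (simp add: F_def norm_mult power_mult_distrib)
         (simp add: power2_eq_square flip: powr_add)
    have u: "set_integrable lborel (annulus (N k)) u"
      unfolding u_def by (intro set_integrable_mult_right set_integral_add wk ck)
    have "(cmod (F 0))\<^sup>2 * A \<le> (LINT z:annulus (N k)|lborel. u z)"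
      unfolding A_def
    proof (rule annulus_submean_value[OF _ u])
      show "F holomorphic_on ball 0 1"
        unfolding F_def by (intro holomorphic_intros entire h)
      show "(cmod (F z))\<^sup>2 \<le> u z" if "z \<in> annulus (N k)" for z
        unfolding sq u_def e_def by (rule point[OF that])
    qed
    also have "\<dots> = B * (4 / e * W k + Y k * A)"
      unfolding u_def W_def A_def using wk ck
      by (simp add: set_integral_const emeasure_annulus mult.commute)
    finally have "e * (a k powr q * (cmod (h 0))\<^sup>2 * A) \<le> e * (B * (4 / e * W k + Y k * A))"
      using e by (intro mult_left_mono) (auto simp: sq Q_0)
    also have "\<dots> = B * (4 * W k + Y k * (e * A))"
      using e by (simp add: field_simps)
    also have "\<dots> \<le> B * (4 * W k + Y k * (pi / 2))"
      using A B by (intro mult_left_mono add_left_mono) (auto simp: Y_def)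
    finally have "a k powr q * (cmod (h 0))\<^sup>2 * (e * A) \<le> B * (4 * W k + Y k * (pi / 2))"
      by (simp add: mult_ac)
    moreover have "a k powr q * (cmod (h 0))\<^sup>2 * (pi / 8) \<le> a k powr q * (cmod (h 0))\<^sup>2 * (e * A)"
      using A by (intro mult_left_mono) auto
    ultimately show ?thesis by linarith
  qed
  have "summable (\<lambda>k. B * (4 * W k + Y k * (pi / 2)))"
    by (intro summable_mult summable_add summable_mult2 sumW sumY)
  then have "summable (\<lambda>k. a k powr q * (cmod (h 0))\<^sup>2 * (pi / 8))"
    by (rule summable_comparison_test') (use int in auto)
  then have "summable (\<lambda>k. ((cmod (h 0))\<^sup>2 * (pi / 8)) * a k powr q)"
    by (simp only: mult_ac)
  then show ?thesis
    using h(2) by (subst (asm) summable_cmult_iff) auto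
qed

end

section \<open>Choice of the coefficients and conclusion\<close>

lemma summable_Suc_powr_iff: "summable (\<lambda>k. real (Suc k) powr c) \<longleftrightarrow> c < -1"
  using summable_Suc_iff[of "\<lambda>k. real k powr c"] summable_real_powr_iff[of c] by simp

lemma multipliers_trivial:
  assumes q: "0 < q" "q < 2" and pq: "q < p"
  shows "multipliers (Dirichlet_type p \<inter> H_infty) (Dirichlet_type q \<inter> H_infty) = {\<lambda>z. 0}"
proof (intro equalityI subsetI)
  fix g assume g: "g \<in> multipliers (Dirichlet_type p \<inter> H_infty) (Dirichlet_type q \<inter> H_infty)"
  \<comment> \<open>The constant 1, set to 0 outside the disc as the normalisation demands; testing
    against it places \<open>g\<close> itself in the target space.\<close>
  define one :: "complex \<Rightarrow> complex" where "one = indicator (ball 0 1)"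
  have an1: "analytic_disc one"
    using holomorphic_transform[of "\<lambda>_. 1" "ball 0 1" one] by (simp add: analytic_disc_def one_def)
  have "deriv one z = 0" if "z \<in> ball 0 1" for z
  proof -
    have "eventually (\<lambda>w. w \<in> ball 0 1) (nhds z)"
      using that by (intro eventually_nhds_in_open) auto
    then have "eventually (\<lambda>w. one w = 1) (nhds z)"
      by eventually_elim (simp add: one_def)
    then have "deriv one z = deriv (\<lambda>w. 1) z" by (rule deriv_cong_ev) simp
    then show ?thesis by simp
  qed
  then have "(\<integral>\<^sup>+ z \<in> ball 0 1. ennreal ((1 / pi) * (1 - cmod z) powr (p - 1) * cmod (deriv one z) powr p) \<partial>lborel)
      = (\<integral>\<^sup>+ z. 0 \<partial>(lborel :: complex measure))"
    by (intro nn_integral_cong) (auto simp: indicator_def)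
  then have "one \<in> Dirichlet_type p \<inter> H_infty"
    using an1 by (auto simp: Dirichlet_type_def H_infty_def one_def indicator_def bounded_iff)
  moreover have "(\<lambda>z. one z * g z) = g"
    using g by (intro ext) (auto simp: multipliers_def analytic_disc_def one_def indicator_def)
  moreover have "(\<lambda>z. F z * g z) \<in> Dirichlet_type q \<inter> H_infty" if "F \<in> Dirichlet_type p \<inter> H_infty" for F
    using g that unfolding multipliers_def by blast
  ultimately have gY: "g \<in> Dirichlet_type q" "g \<in> H_infty"
    by (metis IntE)+
  \<comment> \<open>The sum of the a_k^r converges exactly for r > q, hence for r = p and r = 2 but
    not for r = q.\<close>
  define a where "a k = real (Suc k) powr (- 1 / q)" for k
  have ap: "a k powr r = real (Suc k) powr (- r / q)" for k r
    by (simp add: a_def powr_powr)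
  have sum_a: "summable (\<lambda>k. a k powr r) \<longleftrightarrow> q < r" for r
    unfolding ap summable_Suc_powr_iff using q by (simp add: field_simps)
  interpret golay a
  proof
    show "0 \<le> a k" for k by (simp add: a_def)
    show "a k \<le> 1" for k
      using powr_mono[of "- 1 / q" 0 "real (Suc k)"] q by (simp add: a_def)
    have "(a k)\<^sup>2 = a k powr 2" for k by (simp add: a_def)
    then show "summable (\<lambda>k. (a k)\<^sup>2)" using sum_a[of 2] q by simp
  qed
  have "f \<in> Dirichlet_type p \<inter> H_infty"
    using f_Dirichlet[of p] f_H_infty sum_a[of p] q pq by simp
  then have "(\<lambda>z. f z * g z) \<in> Dirichlet_type q"
    using g by (auto simp: multipliers_def)
  then have "g = (\<lambda>z. 0)"
    using multiplier_imp_summable[OF q gY] sum_a[of q] by blast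
  then show "g \<in> {\<lambda>z. 0}" by simp
next
  fix g :: "complex \<Rightarrow> complex" assume "g \<in> {\<lambda>z. 0}"
  then show "g \<in> multipliers (Dirichlet_type p \<inter> H_infty) (Dirichlet_type q \<inter> H_infty)"
    by (auto simp: multipliers_def Dirichlet_type_def H_infty_def analytic_disc_def bounded_iff)
qed

theorem theorem5:
  shows "(\<forall>p q::real. 0 < q \<and> q < 1 \<and> q < p \<longrightarrow>
           multipliers (Dirichlet_type p \<inter> H_infty) (Dirichlet_type q \<inter> H_infty) = {\<lambda>z. 0}) \<and>
         (\<forall>p q::real. 1 \<le> q \<and> q < 2 \<and> 2 \<le> p \<longrightarrow>
           multipliers (Dirichlet_type p \<inter> H_infty) (Dirichlet_type q \<inter> H_infty) = {\<lambda>z. 0})"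
  using multipliers_trivial by simp

end
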